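(* Let $\alpha,\beta\ge-\frac12$. For all integers $k_1,k_2\ge0$ there exists a polynomial $P^{\alpha,\beta}_{k_1,k_2}\in\Pi^*_{k_1,k_2}$ with leading term $x^{k_1}y^{k_2}$ (in the $*$-order) such that $$\mathcal L_{\alpha,\beta}P^{\alpha,\beta}_{k_1,k_2}=\lambda^{\alpha,\beta}_{k_1,k_2}P^{\alpha,\beta}_{k_1,k_2},$$ where, with $|k|_*=2k_1+3k_2$, $$\lambda^{\alpha,\beta}_{k_1,k_2}=\frac32|k|_*\,(|k|_*+5+4\alpha+6\beta)+\frac92k_2(k_2+1+2\beta).$$ Furthermore, if all the polynomials $P^{\alpha,\beta}_{k_1,k_2}$ ($k_1,k_2\ge0$) are required to be orthogonal to each other with respect to the inner product $\langle\cdot,\cdot\rangle_{w_{\alpha,\beta}}$, then $P^{\alpha,\beta}_{k_1,k_2}$ is uniquely determined by its leading term in the $*$-order.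
   Context: The order $\prec$ on $\mathbb N_0^2$ (the $*$-order): $(k_1,k_2)\prec(j_1,j_2)$ if $2j_1+3j_2>2k_1+3k_2$, or $2(k_1-j_1)=3(j_2-k_2)>0$; $k\preceq j$ means $k\prec j$ or $k=j$. If $p(x,y)=\sum_{(k_1,k_2)\preceq(m,n)}c_{k_1,k_2}x^{k_1}y^{k_2}$ with $c_{m,n}\ne0$, then $c_{m,n}x^my^n$ is the leading term of $p$. $\Pi^*_{m,n}=\mathrm{span}\{x^jy^k:(j,k)\preceq(m,n)\}$. $\triangle^*\subset\mathbb R^2$ is the image of $\triangle=\{(t_1,t_2,t_3)\in\mathbb R^3:t_1+t_2+t_3=0,\ 0\le t_2\le t_1\le-t_3\le1\}$ under the map $\mathbf t\mapsto(x,y)$ with $x=\frac13\left(\cos\frac{2\pi(t_1-t_2)}3+\cos\frac{2\pi(2t_1+t_2)}3+\cos\frac{2\pi(t_1+2t_2)}3\right)$, $y=\frac13\left(\cos2\pi t_1+\cos2\pi t_2+\cos2\pi(t_1+t_2)\right)$; it is the region bounded by the curves $1+2y-3x^2=0$ and $24x^3-y^2-12xy-6x-4y-1=0$, with both of these polynomials positive in its interior. On it, $$w_{\alpha,\beta}(x,y)=\frac{(4\pi^2)^{\alpha+\beta}}{3^{2\alpha+\beta}}(1+2y-3x^2)^\alpha(24x^3-y^2-12xy-6x-4y-1)^\beta,$$ and $\langle f,g\rangle_{w_{\alpha,\beta}}=c_{\alpha,\beta}\int_{\triangle^*}f\,\overline g\,w_{\alpha,\beta}\,dx\,dy$ with $c_{\alpha,\beta}=1/\int_{\triangle^*}w_{\alpha,\beta}\,dx\,dy$.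 The differential operator is $$\mathcal L_{\alpha,\beta}=-A_{11}\partial_x^2-2A_{12}\partial_x\partial_y-A_{22}\partial_y^2+B_1\partial_x+B_2\partial_y,$$ with $A_{11}=-6x^2+y+3x+2$, $A_{12}=-9xy+18x^2-6y-3$, $A_{22}=-18y^2+108x^3-54xy-27x-9y$, $B_1=21x+12\alpha x+18\beta x+6\alpha+3$, $B_2=18x+36\alpha x+18\beta+45y+36\beta y+18\alpha y+9$. (Equivalently $\mathcal L_{\alpha,\beta}=-w_{\alpha,\beta}^{-1}\nabla^{\mathsf T}w_{\alpha,\beta}\Lambda\nabla$ with $\Lambda=(A_{ij})$ symmetric.) *)

theory Defs
  imports "HOL-Analysis.Analysis" "HOL-Computational_Algebra.Polynomial"
begin

section \<open>Bivariate polynomials with complex coefficients\<close>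

text \<open>A polynomial in x and y is a polynomial in y whose coefficients are polynomials in x: the
  coefficient of the monomial with exponents j (of x) and k (of y) in p is \<open>coeff (coeff p k) j\<close>.\<close>

type_synonym bipoly = "complex poly poly"

definition polyX :: bipoly where "polyX = [:[:0, 1:]:]"
definition polyY :: bipoly where "polyY = [:0, 1:]"
definition cst :: "real \<Rightarrow> bipoly" where "cst c = [:[:complex_of_real c:]:]"

definition mon :: "nat \<times> nat \<Rightarrow> bipoly" where
  "mon k = polyX ^ fst k * polyY ^ snd k"

definition scale :: "complex \<Rightarrow> bipoly \<Rightarrow> bipoly" where
  "scale c p = smult [:c:] p"

global_interpretation bipoly: vector_space scale
  by unfold_locales (simp_all add: scale_def smult_add_right smult_add_left [symmetric]
      mult.commute flip: one_pCons)

definition dx :: "bipoly \<Rightarrow> bipoly" where "dx p = map_poly pderiv p"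
definition dy :: "bipoly \<Rightarrow> bipoly" where "dy p = pderiv p"

definition eval2 :: "bipoly \<Rightarrow> real \<Rightarrow> real \<Rightarrow> complex" where
  "eval2 p x y = poly (poly p [:complex_of_real y:]) (complex_of_real x)"

lemma eval2_mon: "eval2 (mon (j, k)) x y = complex_of_real x ^ j * complex_of_real y ^ k"
  by (simp add: eval2_def mon_def polyX_def polyY_def poly_power)

lemma coeff_mon: "coeff (coeff (mon (j, k)) b) a = (if a = j \<and> b = k then 1 else 0)"
proof -
  have X: "polyX ^ j = [:monom 1 j:]"
    by (induction j) (simp_all add: polyX_def one_pCons monom_Suc)
  have Y: "polyY ^ k = monom 1 k"
    by (simp add: polyY_def monom_altdef)
  show ?thesis
    by (simp add: mon_def X Y smult_monom)
qed

lemma dx_mon: "dx (mon (j, k)) = scale (of_nat j) (mon (j - 1, k))"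
  by (rule poly_eqI, rule poly_eqI)
    (auto simp: dx_def scale_def coeff_map_poly coeff_pderiv coeff_mon)


section \<open>The star-order\<close>

text \<open>Exponents are converted to integers because the differences may be negative.\<close>

definition star_less :: "nat \<times> nat \<Rightarrow> nat \<times> nat \<Rightarrow> bool" (infix \<open>\<prec>\<^sub>*\<close> 50) where
  "k \<prec>\<^sub>* j \<longleftrightarrow>
     2 * fst j + 3 * snd j > 2 * fst k + 3 * snd k \<or>
     (2 * (int (fst k) - int (fst j)) = 3 * (int (snd j) - int (snd k)) \<and>
      3 * (int (snd j) - int (snd k)) > 0)"

definition star_le :: "nat \<times> nat \<Rightarrow> nat \<times> nat \<Rightarrow> bool" (infix \<open>\<preceq>\<^sub>*\<close> 50) where
  "k \<preceq>\<^sub>* j \<longleftrightarrow> k \<prec>\<^sub>* j \<or> k = j"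

text \<open>Finiteness ensures that the sum in \<open>leading_term\<close> below is a genuine one.\<close>

lemma finite_star_le: "finite {k. k \<preceq>\<^sub>* j}"
proof (rule finite_subset)
  show "{k. k \<preceq>\<^sub>* j} \<subseteq> {..2 * fst j + 3 * snd j} \<times> {..2 * fst j + 3 * snd j}"
    by (auto simp: star_le_def star_less_def)
qed auto

definition Pi_star :: "nat \<times> nat \<Rightarrow> bipoly set" where
  "Pi_star m = bipoly.span {mon k |k. k \<preceq>\<^sub>* m}"

definition leading_term :: "bipoly \<Rightarrow> bipoly \<Rightarrow> bool" where
  "leading_term p t \<longleftrightarrow>
     (\<exists>m c. p = (\<Sum>k | k \<preceq>\<^sub>* m. scale (c k) (mon k)) \<and> c m \<noteq> 0 \<and> t = scale (c m) (mon m))"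


section \<open>The region, the weight and the inner product\<close>

definition triangle :: "(real \<times> real \<times> real) set" where
  "triangle = {(t1, t2, t3). t1 + t2 + t3 = 0 \<and> 0 \<le> t2 \<and> t2 \<le> t1 \<and> t1 \<le> - t3 \<and> - t3 \<le> 1}"

definition xy_map :: "real \<times> real \<times> real \<Rightarrow> real \<times> real" where
  "xy_map = (\<lambda>(t1, t2, t3).
     (1 / 3 * (cos (2 * pi * (t1 - t2) / 3) + cos (2 * pi * (2 * t1 + t2) / 3)
               + cos (2 * pi * (t1 + 2 * t2) / 3)),
      1 / 3 * (cos (2 * pi * t1) + cos (2 * pi * t2) + cos (2 * pi * (t1 + t2)))))"

definition triangle_star :: "(real \<times> real) set" where
  "triangle_star = xy_map ` triangle"

text \<open>Both bracketed polynomials are positive in the interior of the region; where one of them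
  vanishes, \<open>powr\<close> returns 0, which only concerns the boundary, a null set.\<close>

definition weight :: "real \<Rightarrow> real \<Rightarrow> real \<times> real \<Rightarrow> real" where
  "weight \<alpha> \<beta> = (\<lambda>(x, y).
     (4 * pi\<^sup>2) powr (\<alpha> + \<beta>) / 3 powr (2 * \<alpha> + \<beta>)
     * (1 + 2 * y - 3 * x\<^sup>2) powr \<alpha>
     * (24 * x ^ 3 - y\<^sup>2 - 12 * x * y - 6 * x - 4 * y - 1) powr \<beta>)"

definition norm_const :: "real \<Rightarrow> real \<Rightarrow> real" where
  "norm_const \<alpha> \<beta> = 1 / set_lebesgue_integral lborel triangle_star (weight \<alpha> \<beta>)"

definition inner_w :: "real \<Rightarrow> real \<Rightarrow> bipoly \<Rightarrow> bipoly \<Rightarrow> complex" where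
  "inner_w \<alpha> \<beta> f g = complex_of_real (norm_const \<alpha> \<beta>) *
     set_lebesgue_integral lborel triangle_star
       (\<lambda>(x, y). eval2 f x y * cnj (eval2 g x y) * complex_of_real (weight \<alpha> \<beta> (x, y)))"


section \<open>The differential operator and its eigenvalues\<close>

definition A11 :: bipoly where
  "A11 = - 6 * polyX\<^sup>2 + polyY + 3 * polyX + 2"
definition A12 :: bipoly where
  "A12 = - 9 * polyX * polyY + 18 * polyX\<^sup>2 - 6 * polyY - 3"
definition A22 :: bipoly where
  "A22 = - 18 * polyY\<^sup>2 + 108 * polyX ^ 3 - 54 * polyX * polyY - 27 * polyX - 9 * polyY"
definition B1 :: "real \<Rightarrow> real \<Rightarrow> bipoly" where
  "B1 \<alpha> \<beta> = 21 * polyX + 12 * cst \<alpha> * polyX + 18 * cst \<beta> * polyX + 6 * cst \<alpha> + 3"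
definition B2 :: "real \<Rightarrow> real \<Rightarrow> bipoly" where
  "B2 \<alpha> \<beta> = 18 * polyX + 36 * cst \<alpha> * polyX + 18 * cst \<beta> + 45 * polyY + 36 * cst \<beta> * polyY
            + 18 * cst \<alpha> * polyY + 9"

definition L_op :: "real \<Rightarrow> real \<Rightarrow> bipoly \<Rightarrow> bipoly" where
  "L_op \<alpha> \<beta> p = - A11 * dx (dx p) - 2 * A12 * dx (dy p) - A22 * dy (dy p)
                + B1 \<alpha> \<beta> * dx p + B2 \<alpha> \<beta> * dy p"

definition star_deg :: "nat \<times> nat \<Rightarrow> nat" where
  "star_deg k = 2 * fst k + 3 * snd k"

definition eigenval :: "real \<Rightarrow> real \<Rightarrow> nat \<times> nat \<Rightarrow> real" where
  "eigenval \<alpha> \<beta> k =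
     3 / 2 * real (star_deg k) * (real (star_deg k) + 5 + 4 * \<alpha> + 6 * \<beta>)
     + 9 / 2 * real (snd k) * (real (snd k) + 1 + 2 * \<beta>)"

end

theory Submission
  imports Defs
begin

text \<open>Different exponents may share an eigenvalue, so triangularity of the operator does not by itself
  give eigenfunctions. Instead, let P k be obtained from the monomial of exponent k by the Gram-Schmidt
  process along the star-order, that is, the unique polynomial with leading term mon k that is
  orthogonal to all earlier monomials. The operator is triangular with the eigenvalues on the diagonal,
  and it is symmetric with respect to the inner product; hence the difference of the operator applied
  to P k and the eigenvalue times P k lies in the span of the earlier monomials and is orthogonal to
  it, so it vanishes. Symmetry is an integration by parts in which the boundary contributes nothing,
  since the fields to which the operator gives rise are tangent to both boundary curves.\<close>

section \<open>The region\<close>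

text \<open>The region enters only through its two boundary polynomials: both are non-negative on
  \<open>triangle_star\<close>, and each point where both are positive gets an explicit preimage in
  the triangle, so no change of variables is needed. The obstacle is integrability down to both
  exponents -1/2, where the weight blows up along both curves, which meet each other. On a vertical
  slice it is then dominated by a multiple of an arcsine density, whose integral does not depend on
  the length of the slice, so slices that shrink to a point do no harm. Only the merging of two
  singularities, at x = -1/3, costs a factor, 1 / sqrt |3 x + 1|, and this is integrable in x.
  Symmetry is used in the form of Lagrange's identity: times the weight, (L f) g - f (L g) is minus
  the divergence of the weight times a single field, so only one integral has to vanish.\<close>

definition parab :: "real \<Rightarrow> real \<Rightarrow> real" where
  "parab x y = 1 + 2 * y - 3 * x\<^sup>2"

definition cubic :: "real \<Rightarrow> real \<Rightarrow> real" where
  "cubic x y = 24 * x ^ 3 - y\<^sup>2 - 12 * x * y - 6 * x - 4 * y - 1"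

definition region :: "(real \<times> real) set" where
  "region = {(x, y). 0 < parab x y \<and> 0 < cubic x y}"

text \<open>As a quadratic in y, cubic has the discriminant 12 (2 x + 1)^3, which the substitution
  x = (3 u^2 - 1) / 2 turns into a square.\<close>

lemma parab_param:
  "parab ((3 * u\<^sup>2 - 1) / 2) y = 2 * (y - (27 * u ^ 4 - 18 * u\<^sup>2 - 1) / 8)"
  unfolding parab_def by (simp add: field_simps power2_eq_square power4_eq_xxxx)

lemma cubic_param:
  "cubic ((3 * u\<^sup>2 - 1) / 2) y = (1 - 9 * u\<^sup>2 + 9 * u ^ 3 - y) * (y - (1 - 9 * u\<^sup>2 - 9 * u ^ 3))"
  unfolding cubic_def by (simp add: field_simps power2_eq_square power3_eq_cube)

text \<open>The cubic is 3 (2 x + 1)^3 minus a square, so its positivity forces 2 x + 1 > 0 and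
  makes u available; y then lies between the two branches of the cubic.\<close>

lemma region_param:
  assumes "(x, y) \<in> region"
  obtains u where "0 < u" "u < 1" "x = (3 * u\<^sup>2 - 1) / 2"
    "27 * u ^ 4 - 18 * u\<^sup>2 - 1 < 8 * y"
    "1 - 9 * u\<^sup>2 - 9 * u ^ 3 < y" "y < 1 - 9 * u\<^sup>2 + 9 * u ^ 3"
proof -
  have p: "0 < parab x y" and c: "0 < cubic x y"
    using assms by (auto simp: region_def)
  have "cubic x y = 3 * (2 * x + 1) ^ 3 - (y + 6 * x + 2)\<^sup>2"
    unfolding cubic_def by (simp add: algebra_simps power2_eq_square power3_eq_cube)
  then have "0 < (2 * x + 1) ^ 3"
    using c zero_le_power2[of "y + 6 * x + 2"] by linarith
  then have x: "0 < 2 * x + 1"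
    by (simp add: zero_less_power_eq)
  define u where "u = sqrt ((2 * x + 1) / 3)"
  have u: "0 < u" using x by (simp add: u_def)
  have xu: "x = (3 * u\<^sup>2 - 1) / 2"
  proof -
    have "u\<^sup>2 = (2 * x + 1) / 3" using x by (simp add: u_def)
    then show ?thesis by (simp add: field_simps)
  qed
  have "0 < (1 - 9 * u\<^sup>2 + 9 * u ^ 3 - y) * (y - (1 - 9 * u\<^sup>2 - 9 * u ^ 3))"
    using c unfolding xu cubic_param .
  moreover have "0 < u ^ 3" using u by simp
  ultimately have y: "y < 1 - 9 * u\<^sup>2 + 9 * u ^ 3" "1 - 9 * u\<^sup>2 - 9 * u ^ 3 < y"
    unfolding zero_less_mult_iff by linarith+
  have y0: "27 * u ^ 4 - 18 * u\<^sup>2 - 1 < 8 * y"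
    using p unfolding xu parab_param by simp
  \<comment> \<open>On this slice y lies above the parabola and below the upper branch. The
    difference of these curves has a triple zero at u = 1 and a second factor that is positive, so
    its sign gives u < 1.\<close>
  have "(u - 1) ^ 3 * (27 * u + 9) =
      27 * u ^ 4 - 18 * u\<^sup>2 - 1 - 8 * (1 - 9 * u\<^sup>2 + 9 * u ^ 3)"
    by (simp add: algebra_simps power2_eq_square power3_eq_cube power4_eq_xxxx)
  also have "\<dots> < 0" using y0 y by simp
  finally have "(u - 1) ^ 3 < 0"
    using u by (simp add: mult_less_0_iff)
  then have "u < 1" by simp
  with u xu y0 y show ?thesis by (intro that)
qed

lemma region_bounded: "region \<subseteq> {-1..1} \<times> {-1..1}"
proof safe
  fix x y assume "(x, y) \<in> region"
  then obtain u where u: "0 < u" "u < 1" "x = (3 * u\<^sup>2 - 1) / 2"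
    "27 * u ^ 4 - 18 * u\<^sup>2 - 1 < 8 * y" "y < 1 - 9 * u\<^sup>2 + 9 * u ^ 3"
    by (rule region_param)
  have "u\<^sup>2 \<le> 1" "0 \<le> u\<^sup>2" using u by (auto simp: power_le_one)
  moreover have "2 * x + 1 = 3 * u\<^sup>2" using u(3) by simp
  ultimately show "x \<in> {-1..1}" unfolding atLeastAtMost_iff by linarith
  have "u ^ 3 \<le> u\<^sup>2" using u by (intro power_decreasing) auto
  moreover have "27 * u ^ 4 - 18 * u\<^sup>2 - 1 = 27 * (u\<^sup>2 - 1 / 3)\<^sup>2 - 4"
    by (simp add: algebra_simps power2_eq_square power4_eq_xxxx)
  then have "- 1 < y" using u(4) zero_le_power2[of "u\<^sup>2 - 1 / 3"] by linarith
  ultimately show "y \<in> {-1..1}" using u(5) by auto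
qed

text \<open>The coordinates of the point of the region with c = cos S and d = cos D, where
  S = pi (2 t1 + t2) / 3 and D = pi t2.\<close>

definition cos_x :: "real \<Rightarrow> real \<Rightarrow> real" where
  "cos_x c d = (2 * c * d + 2 * c\<^sup>2 - 1) / 3"

definition cos_y :: "real \<Rightarrow> real \<Rightarrow> real" where
  "cos_y c d = (2 * (4 * c ^ 3 - 3 * c) * d + 2 * d\<^sup>2 - 1) / 3"

lemma xy_map_cos:
  "xy_map ((3 * S - D) / (2 * pi), D / pi, t) = (cos_x (cos S) (cos D), cos_y (cos S) (cos D))"
proof -
  have e: "2 * pi * ((3 * S - D) / (2 * pi) - D / pi) / 3 = S - D"
    "2 * pi * (2 * ((3 * S - D) / (2 * pi)) + D / pi) / 3 = 2 * S"
    "2 * pi * ((3 * S - D) / (2 * pi) + 2 * (D / pi)) / 3 = S + D"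
    "2 * pi * ((3 * S - D) / (2 * pi)) = 3 * S - D"
    "2 * pi * (D / pi) = 2 * D"
    "2 * pi * ((3 * S - D) / (2 * pi) + D / pi) = 3 * S + D"
    by (simp_all add: field_simps)
  have "cos (S - D) + cos (2 * S) + cos (S + D) = 2 * cos S * cos D + 2 * (cos S)\<^sup>2 - 1"
    by (simp add: cos_add cos_diff cos_double_cos)
  moreover have "cos (3 * S - D) + cos (2 * D) + cos (3 * S + D) =
      2 * (4 * cos S ^ 3 - 3 * cos S) * cos D + 2 * (cos D)\<^sup>2 - 1"
    unfolding cos_treble_cos[symmetric] by (simp add: cos_add cos_diff cos_double_cos)
  ultimately show ?thesis
    unfolding xy_map_def prod.case e cos_x_def cos_y_def by simp
qed

text \<open>For cosines c and d the factors 1 - c^2 and 1 - d^2 are squares of sines, so here and in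
  \<open>cubic_cos\<close> non-negativity can be read off. The term \<open>4 * c ^ 3 - 3 * c\<close>
  is cos 3S.\<close>

lemma parab_cos: "parab (cos_x c d) (cos_y c d) = 4 / 3 * (1 - c\<^sup>2) * (c - d)\<^sup>2"
  unfolding parab_def cos_x_def cos_y_def
  by (simp add: field_simps power2_eq_square power3_eq_cube)

lemma cubic_cos: "cubic (cos_x c d) (cos_y c d) = 4 / 9 * (1 - d\<^sup>2) * (d - (4 * c ^ 3 - 3 * c))\<^sup>2"
  unfolding cubic_def cos_x_def cos_y_def
  by (simp add: field_simps power2_eq_square power3_eq_cube)

lemma triangle_star_nonneg:
  assumes "(x, y) \<in> triangle_star"
  shows "0 \<le> parab x y" "0 \<le> cubic x y"
proof -
  obtain t1 t2 t3 where t: "(x, y) = xy_map (t1, t2, t3)"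
    using assms by (auto simp: triangle_star_def)
  define D where "D = pi * t2"
  define S where "S = (2 * pi * t1 + D) / 3"
  have eqs: "t1 = (3 * S - D) / (2 * pi)" "t2 = D / pi"
    by (simp_all add: S_def D_def field_simps)
  have xy: "x = cos_x (cos S) (cos D)" "y = cos_y (cos S) (cos D)"
    using t xy_map_cos[of S D t3] unfolding eqs by simp_all
  have "0 \<le> 1 - (cos S)\<^sup>2" "0 \<le> 1 - (cos D)\<^sup>2"
    by (simp_all add: abs_square_le_1)
  then show "0 \<le> parab x y" "0 \<le> cubic x y"
    unfolding xy parab_cos cubic_cos by (auto intro!: mult_nonneg_nonneg)
qed

text \<open>The inequalities of the triangle are 0 \<le> D \<le> S and 3S + D \<le> 2 pi, restated
  for cosines. The last one is automatic for c \<ge> 0, where D \<le> S \<le> pi / 2. Otherwise S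
  lies in [pi / 2, 2 pi / 3], so 2 pi - 3S lies in [0, pi / 2], where the cosine reverses the order
  and takes the value \<open>4 * c ^ 3 - 3 * c\<close>.\<close>

lemma cos_coords_in_triangle_star:
  assumes "- 1 / 2 \<le> c" "c \<le> d" "d \<le> 1" "4 * c ^ 3 - 3 * c \<le> d \<or> 0 \<le> c" "0 \<le> d"
  shows "(cos_x c d, cos_y c d) \<in> triangle_star"
proof -
  define S D where "S = arccos c" and "D = arccos d"
  have c: "cos S = c" and d: "cos D = d"
    using assms by (simp_all add: S_def D_def)
  have D: "0 \<le> D" "D \<le> S"
    using assms by (auto simp: S_def D_def intro!: arccos_lbound arccos_le_arccos)
  have SD: "3 * S + D \<le> 2 * pi"
  proof (cases "0 \<le> c")
    case True
    then have "S \<le> pi / 2"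
      unfolding S_def using arccos_le_arccos[of 0 c] assms by simp
    then show ?thesis using D by linarith
  next
    case False
    have "S \<ge> pi / 2"
      unfolding S_def using arccos_le_arccos[of c 0] False assms by simp
    moreover have "S \<le> 2 * pi / 3"
      using arccos_le_arccos[of "- 1 / 2" c] arccos_cos[of "2 * pi / 3"] assms pi_gt_zero
      by (simp add: S_def cos_120)
    moreover have "cos (2 * pi - 3 * S) \<le> cos D"
      using assms False unfolding d by (simp add: cos_diff cos_treble_cos c)
    then have "D \<le> 2 * pi - 3 * S"
      using calculation D pi_gt_zero by (subst (asm) cos_mono_le_eq) (auto simp: D_def arccos_ubound assms)
    then show ?thesis by simp
  qed
  have "((3 * S - D) / (2 * pi), D / pi, - ((3 * S - D) / (2 * pi) + D / pi)) \<in> triangle"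
    using D SD pi_gt_zero by (auto simp: triangle_def field_simps)
  then have "xy_map ((3 * S - D) / (2 * pi), D / pi, - ((3 * S - D) / (2 * pi) + D / pi))
      \<in> triangle_star"
    unfolding triangle_star_def by (rule imageI)
  then show ?thesis unfolding xy_map_cos c d .
qed

lemma region_subset_triangle_star: "region \<subseteq> triangle_star"
  \<comment> \<open>For fixed x the relation cos_x c d = x determines d as a function of c, and y then runs through
    the whole vertical slice by the intermediate value theorem.\<close>
proof safe
  fix x y assume "(x, y) \<in> region"
  then obtain u where u: "0 < u" "u < 1" "x = (3 * u\<^sup>2 - 1) / 2"
    and y: "27 * u ^ 4 - 18 * u\<^sup>2 - 1 < 8 * y" "1 - 9 * u\<^sup>2 - 9 * u ^ 3 < y"
      "y < 1 - 9 * u\<^sup>2 + 9 * u ^ 3"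
    by (rule region_param)
  \<comment> \<open>Solves \<open>cos_x c d = x\<close> for d. The pole at c = 0 and the sign in 9
    u^2 - 1 = 4 c (c + d) account for the three cases. The value \<open>c1\<close> below solves d =
    1, that is (2 c + 1)^2 = 9 u^2; it belongs to the upper branch.\<close>
  define d where "d c = (9 * u\<^sup>2 - 1) / (4 * c) - c" for c
  define c1 where "c1 = (3 * u - 1) / 2"
  have x: "cos_x c (d c) = x" if "c \<noteq> 0" for c
    using that by (simp add: u cos_x_def d_def field_simps power2_eq_square)
  have cont: "continuous_on {a..b} (\<lambda>c. cos_y c (d c))" if "0 \<notin> {a..b}" for a b
    unfolding cos_y_def d_def using that by (auto intro!: continuous_intros)
  have d1: "d c1 = 1" if "c1 \<noteq> 0"
  proof -
    have "9 * u\<^sup>2 - 1 = 4 * c1 * (1 + c1)"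
      by (simp add: c1_def field_simps power2_eq_square)
    then show ?thesis using that by (simp add: d_def field_simps)
  qed
  have y1: "cos_y c1 1 = 1 - 9 * u\<^sup>2 + 9 * u ^ 3"
    by (simp add: cos_y_def c1_def field_simps power2_eq_square power3_eq_cube)
  consider "1 / 3 < u" | "u = 1 / 3" | "u < 1 / 3" by linarith
  then show "(x, y) \<in> triangle_star"
  proof cases
    case 1
    then have c1: "0 < c1" by (simp add: c1_def)
    \<comment> \<open>The solution of \<open>d c = c\<close>, the side of the triangle that is
      mapped to the parabola.\<close>
    define c0 where "c0 = sqrt ((9 * u\<^sup>2 - 1) / 8)"
    have k: "0 < 9 * u\<^sup>2 - 1"
    proof -
      have "9 * u\<^sup>2 - 1 = (3 * u - 1) * (3 * u + 1)"
        by (simp add: algebra_simps power2_eq_square)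
      then show ?thesis using 1 by simp
    qed
    then have c0: "c0\<^sup>2 = (9 * u\<^sup>2 - 1) / 8" "0 < c0" by (simp_all add: c0_def)
    have "c1\<^sup>2 \<le> c0\<^sup>2"
    proof -
      have "c0\<^sup>2 - c1\<^sup>2 = (3 * u - 1) * (3 - 3 * u) / 8"
        unfolding c0 c1_def by (simp add: field_simps power2_eq_square)
      also have "\<dots> \<ge> 0" using 1 u by simp
      finally show ?thesis by simp
    qed
    then have le: "c1 \<le> c0" using c0(2) power2_le_imp_le[of c1 c0] by simp
    have d0: "d c0 = c0"
    proof -
      have "9 * u\<^sup>2 - 1 = 8 * c0\<^sup>2" using c0 by simp
      then have "d c0 = 8 * c0\<^sup>2 / (4 * c0) - c0" by (simp only: d_def)
      then show ?thesis using c0(2) by (simp add: power2_eq_square)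
    qed
    have "cos_y c0 c0 = (8 * (c0\<^sup>2)\<^sup>2 - 4 * c0\<^sup>2 - 1) / 3"
      by (simp add: cos_y_def algebra_simps power2_eq_square power3_eq_cube)
    also have "\<dots> = (27 * u ^ 4 - 18 * u\<^sup>2 - 1) / 8"
      unfolding c0(1) by algebra
    finally have "cos_y c0 (d c0) \<le> y" "y \<le> cos_y c1 (d c1)"
      using y y1 d0 d1 c1 by simp_all
    then obtain c where c: "c1 \<le> c" "c \<le> c0" "cos_y c (d c) = y"
      using IVT2'[of "\<lambda>c. cos_y c (d c)" c0 y c1] le cont[of c1 c0] c1 by auto
    have pos: "0 < c" using c c1 by simp
    have "4 * c * (d c - c) = 8 * (c0\<^sup>2 - c\<^sup>2)"
      unfolding d_def c0 using pos by (simp add: field_simps power2_eq_square)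
    also have "\<dots> \<ge> 0" using c pos by (simp add: power_mono)
    finally have "c \<le> d c" using pos by (simp add: zero_le_mult_iff)
    moreover have "4 * c * (1 - d c) = 4 * (c - c1) * (c + c1 + 1)"
      unfolding d_def c1_def using pos by (simp add: field_simps power2_eq_square)
    then have "0 \<le> 4 * c * (1 - d c)" using c pos c1 by simp
    then have "d c \<le> 1" using pos by (simp add: zero_le_mult_iff)
    ultimately have "(cos_x c (d c), cos_y c (d c)) \<in> triangle_star"
      using pos by (intro cos_coords_in_triangle_star) auto
    then show ?thesis using x c pos by simp
  next
    case 2
    \<comment> \<open>For u = 1/3 the choice c = 0 gives the right x for every d, and d is found
      from \<open>cos_y 0 d = y\<close>.\<close>
    define e where "e = sqrt ((3 * y + 1) / 2)"
    have yb: "- 1 / 3 < y" "y < 1 / 3"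
      using y unfolding 2 by (simp_all add: power_divide)
    then have e: "e\<^sup>2 = (3 * y + 1) / 2" "0 \<le> e" "e \<le> 1" by (auto simp: e_def)
    have "cos_x 0 e = x" "cos_y 0 e = y"
      using e(1) by (simp_all add: cos_x_def cos_y_def u 2 power_divide)
    moreover have "(cos_x 0 e, cos_y 0 e) \<in> triangle_star"
      using e by (intro cos_coords_in_triangle_star) auto
    ultimately show ?thesis by simp
  next
    case 3
    then have c1: "c1 < 0" by (simp add: c1_def)
    \<comment> \<open>The negative solution of \<open>d c = 4 * c ^ 3 - 3 * c\<close>, which amounts
      to 1 - 4 c^2 = 3 u. This is the side 3S + D = 2 pi, mapped to the lower branch of the
      cubic.\<close>
    define c0 where "c0 = - (sqrt (1 - 3 * u) / 2)"
    have c0: "c0\<^sup>2 = (1 - 3 * u) / 4" "c0 < 0"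
      using 3 by (simp_all add: c0_def power_divide)
    have "c1\<^sup>2 \<le> c0\<^sup>2"
    proof -
      have "c0\<^sup>2 - c1\<^sup>2 = (1 - 3 * u) * (3 * u) / 4"
        unfolding c0 c1_def by (simp add: field_simps power2_eq_square)
      also have "\<dots> \<ge> 0" using 3 u by simp
      finally show ?thesis by simp
    qed
    then have le: "c0 \<le> c1" using c0(2) c1 abs_le_square_iff[of c1 c0] by simp
    have c0h: "- 1 / 2 \<le> c0"
      using u by (simp add: c0_def)
    have d0: "d c0 = - c0 * (2 + 3 * u)"
    proof -
      have "9 * u\<^sup>2 - 1 = - 4 * c0\<^sup>2 * (1 + 3 * u)"
        unfolding c0 by (simp add: field_simps power2_eq_square)
      then have "d c0 = - 4 * c0\<^sup>2 * (1 + 3 * u) / (4 * c0) - c0" by (simp only: d_def)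
      also have "- 4 * c0\<^sup>2 * (1 + 3 * u) / (4 * c0) = - c0 * (1 + 3 * u)"
        using c0(2) by (simp add: power2_eq_square)
      finally show ?thesis by (simp add: algebra_simps)
    qed
    have u_c0: "u = (1 - 4 * c0\<^sup>2) / 3" unfolding c0(1) by (simp add: field_simps)
    have "cos_y c0 (d c0) = 1 - 9 * u\<^sup>2 - 9 * u ^ 3"
      unfolding d0 cos_y_def u_c0 by (simp add: field_simps power2_eq_square power3_eq_cube)
    then have "cos_y c0 (d c0) \<le> y" "y \<le> cos_y c1 (d c1)"
      using y y1 d1 c1 by simp_all
    then obtain c where c: "c0 \<le> c" "c \<le> c1" "cos_y c (d c) = y"
      using IVT'[of "\<lambda>c. cos_y c (d c)" c0 y c1] le cont[of c0 c1] c1 by auto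
    have neg: "c < 0" using c c1 by simp
    have "c\<^sup>2 \<le> c0\<^sup>2"
      using c neg abs_le_square_iff[of c c0] by simp
    then have k: "3 * u \<le> 1 - 4 * c\<^sup>2" unfolding c0 by simp
    then have "(3 * u)\<^sup>2 \<le> (1 - 4 * c\<^sup>2)\<^sup>2" using u by (intro power_mono) auto
    moreover have "4 * (- c) * (d c - (4 * c ^ 3 - 3 * c)) = (1 - 4 * c\<^sup>2)\<^sup>2 - (3 * u)\<^sup>2"
      unfolding d_def using neg
      by (simp add: field_simps power2_eq_square power3_eq_cube)
    ultimately have "0 \<le> 4 * (- c) * (d c - (4 * c ^ 3 - 3 * c))" by simp
    then have dl: "4 * c ^ 3 - 3 * c \<le> d c" using neg by (simp add: zero_le_mult_iff mult_le_0_iff)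
    have "4 * (- c) * (1 - d c) = 4 * (c1 - c) * (c + (1 + 3 * u) / 2)"
      unfolding d_def c1_def using neg by (simp add: field_simps power2_eq_square)
    also have "\<dots> \<ge> 0"
    proof (intro mult_nonneg_nonneg)
      show "0 \<le> c + (1 + 3 * u) / 2" using c c0h u by (simp add: field_simps)
    qed (use c in simp_all)
    finally have d_le: "d c \<le> 1" using neg by (simp add: zero_le_mult_iff mult_le_0_iff)
    have "4 * c ^ 3 - 3 * c = (- c) * (3 - 4 * c\<^sup>2)"
      by (simp add: algebra_simps power2_eq_square power3_eq_cube)
    moreover have "0 \<le> (- c) * (3 - 4 * c\<^sup>2)"
      using neg k u by (intro mult_nonneg_nonneg) auto
    ultimately have "0 \<le> d c" using dl by simp
    then have "(cos_x c (d c), cos_y c (d c)) \<in> triangle_star"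
      using neg dl d_le c c0h by (intro cos_coords_in_triangle_star) auto
    then show ?thesis using x c neg by simp
  qed
qed

section \<open>Integrability of the weight\<close>

lemma nn_integral_arcsin_density:
  fixes a c :: real
  assumes "a < c"
  shows "(\<integral>\<^sup>+ y. ennreal (1 / sqrt ((y - a) * (c - y))) * indicator {a..c} y \<partial>lborel) = ennreal pi"
proof -
  define F where "F y = arcsin ((2 * y - a - c) / (c - a))" for y
  have "((\<lambda>y. 1 / sqrt ((y - a) * (c - y))) has_integral (F c - F a)) {a..c}"
  proof (rule fundamental_theorem_of_calculus_interior)
    show "a \<le> c" using assms by simp
    show "continuous_on {a..c} F"
      unfolding F_def using assms by (intro continuous_intros) (auto simp: field_simps)
    show "(F has_vector_derivative 1 / sqrt ((y - a) * (c - y))) (at y)" if "y \<in> {a<..<c}" for y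
    proof -
      define z where "z = (2 * y - a - c) / (c - a)"
      have z: "- 1 < z" "z < 1" using that assms by (simp_all add: z_def field_simps)
      have "1 - z\<^sup>2 = (4 * ((y - a) * (c - y))) / (c - a)\<^sup>2"
      proof -
        have "(c - a)\<^sup>2 - (2 * y - a - c)\<^sup>2 = 4 * ((y - a) * (c - y))"
          by (simp add: power2_eq_square algebra_simps)
        then show ?thesis
          using assms by (simp add: z_def power_divide field_simps)
      qed
      then have "sqrt (1 - z\<^sup>2) = 2 * sqrt ((y - a) * (c - y)) / (c - a)"
        using assms by (simp add: real_sqrt_divide real_sqrt_mult)
      then have "inverse (sqrt (1 - z\<^sup>2)) * (2 / (c - a)) = 1 / sqrt ((y - a) * (c - y))"
        using assms that by (simp add: field_simps)
      moreover have "(arcsin has_real_derivative inverse (sqrt (1 - z\<^sup>2))) (at z)"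
        using z by (rule DERIV_arcsin)
      moreover have "((\<lambda>y. (2 * y - a - c) / (c - a)) has_real_derivative 2 / (c - a)) (at y)"
        by (rule DERIV_cdivide) (auto intro!: derivative_eq_intros)
      ultimately have "(F has_real_derivative 1 / sqrt ((y - a) * (c - y))) (at y)"
        unfolding F_def using DERIV_chain2[of arcsin _ "\<lambda>y. (2 * y - a - c) / (c - a)" y "2 / (c - a)" UNIV]
        by (metis z_def)
      then show ?thesis by (simp add: has_real_derivative_iff_has_vector_derivative)
    qed
  qed
  moreover have "F c - F a = pi"
  proof -
    have "(2 * c - a - c) / (c - a) = 1" "(2 * a - a - c) / (c - a) = - 1"
      using assms by (simp_all add: field_simps)
    then show ?thesis by (simp add: F_def)
  qed
  ultimately show ?thesis
    by (intro nn_integral_has_integral_lebesgue') auto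
qed

lemma nn_integral_inverse_sqrt_finite:
  "(\<integral>\<^sup>+ x. ennreal (pi / sqrt \<bar>3 * x + 1\<bar>) * indicator {- 1..1} x \<partial>lborel) < \<infinity>"
proof -
  \<comment> \<open>As \<open>sqrt\<close> is extended to negative arguments as an odd function, a
    single continuous primitive passes through the singularity at -1/3.\<close>
  define F where "F x = pi * (2 / 3) * sqrt (3 * x + 1)" for x
  have "((\<lambda>x. pi / sqrt \<bar>3 * x + 1\<bar>) has_integral (F 1 - F (- 1))) {- 1..1}"
  proof (rule fundamental_theorem_of_calculus_interior_strong)
    show "finite {- 1 / 3 :: real}" by simp
    show "continuous_on {- 1..1} F" unfolding F_def by (intro continuous_intros)
    fix x :: real assume x: "x \<in> {- 1<..<1} - {- 1 / 3}"
    define D where "D = pi * (2 / 3) * ((inverse (sqrt \<bar>3 * x + 1\<bar>) / 2) * 3)"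
    have "(sqrt has_real_derivative inverse (sqrt \<bar>3 * x + 1\<bar>) / 2) (at (3 * x + 1))"
      using x real_sqrt_minus[of "3 * x + 1"]
      by (intro DERIV_real_sqrt_generic) (auto simp: abs_if)
    moreover have "((\<lambda>x. 3 * x + 1) has_real_derivative 3) (at x)"
      by (auto intro!: derivative_eq_intros)
    ultimately have "((\<lambda>x. sqrt (3 * x + 1)) has_real_derivative
        (inverse (sqrt \<bar>3 * x + 1\<bar>) / 2) * 3) (at x)"
      by (rule DERIV_chain2)
    then have "(F has_real_derivative D) (at x)"
      unfolding F_def D_def by (rule DERIV_cmult)
    then show "(F has_vector_derivative pi / sqrt \<bar>3 * x + 1\<bar>) (at x)"
      by (simp add: D_def has_real_derivative_iff_has_vector_derivative field_simps)
  qed auto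
  then have "(\<integral>\<^sup>+ x. ennreal (pi / sqrt \<bar>3 * x + 1\<bar>) * indicator {- 1..1} x \<partial>lborel)
      = ennreal (F 1 - F (- 1))"
    by (intro nn_integral_has_integral_lebesgue') auto
  then show ?thesis by simp
qed

text \<open>On a vertical slice, parab * cubic is a constant times the product of the distances from y to the
  parabola and to the two branches of the cubic. The factor |3 x + 1| bounds from below the gap between
  the two lower curves, which cross at x = - 1 / 3.\<close>

lemma region_slice:
  fixes x :: real
  obtains a c where "\<And>y. (x, y) \<in> region \<Longrightarrow> a < y \<and> y < c \<and>
    \<bar>3 * x + 1\<bar> * ((y - a) * (c - y)) \<le> parab x y * cubic x y"
proof -
  define u where "u = sqrt ((2 * x + 1) / 3)"
  define y0 where "y0 = (27 * u ^ 4 - 18 * u\<^sup>2 - 1) / 8"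
  define y1 where "y1 = 1 - 9 * u\<^sup>2 - 9 * u ^ 3"
  define a c where "a = max y0 y1" and "c = 1 - 9 * u\<^sup>2 + 9 * u ^ 3"
  have "a < y \<and> y < c \<and> \<bar>3 * x + 1\<bar> * ((y - a) * (c - y)) \<le> parab x y * cubic x y"
    if R: "(x, y) \<in> region" for y
  proof -
    obtain v where v: "0 < v" "v < 1" "x = (3 * v\<^sup>2 - 1) / 2"
      "27 * v ^ 4 - 18 * v\<^sup>2 - 1 < 8 * y" "1 - 9 * v\<^sup>2 - 9 * v ^ 3 < y"
      "y < 1 - 9 * v\<^sup>2 + 9 * v ^ 3"
      using R by (rule region_param)
    have [simp]: "v = u"
    proof -
      have "(2 * x + 1) / 3 = v\<^sup>2" unfolding v(3) by (simp add: field_simps)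
      then show ?thesis using v(1) by (simp add: u_def)
    qed
    have u: "0 < u" "u < 1" using v by simp_all
    have y: "y0 < y" "y1 < y" "y < c"
      using v by (simp_all add: y0_def y1_def c_def)
    have p: "parab x y = 2 * (y - y0)" and q: "cubic x y = (c - y) * (y - y1)"
      unfolding v(3) y0_def y1_def c_def by (simp_all add: parab_param cubic_param)
    \<comment> \<open>The identity behind u < 1 in \<open>region_param\<close> with u replaced by
      -u, which turns the upper branch into the lower one. Its zero u = 1/3 corresponds to x =
      -1/3.\<close>
    have "(u + 1) ^ 3 * (27 * u - 9) = 8 * (y0 - y1)"
      unfolding y0_def y1_def by algebra
    then have "8 * \<bar>y0 - y1\<bar> = (u + 1) ^ 3 * \<bar>27 * u - 9\<bar>"
      using u by (metis abs_mult abs_numeral abs_of_nonneg add_nonneg_nonneg less_imp_le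
          zero_le_one zero_le_power)
    moreover have "1 * \<bar>27 * u - 9\<bar> \<le> (u + 1) ^ 3 * \<bar>27 * u - 9\<bar>"
      using u by (intro mult_right_mono one_le_power) auto
    moreover have "\<bar>3 * x + 1\<bar> = \<bar>3 * u - 1\<bar> * ((3 * u + 1) / 2)"
    proof -
      have "3 * x + 1 = (3 * u - 1) * ((3 * u + 1) / 2)"
        unfolding v(3) by (simp add: field_simps power2_eq_square)
      then have "\<bar>3 * x + 1\<bar> = \<bar>3 * u - 1\<bar> * \<bar>(3 * u + 1) / 2\<bar>" by (simp only: abs_mult)
      then show ?thesis using u by simp
    qed
    moreover have "\<bar>3 * u - 1\<bar> * ((3 * u + 1) / 2) \<le> \<bar>3 * u - 1\<bar> * 2"
      using u by (intro mult_left_mono) auto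
    moreover have "\<bar>27 * u - 9\<bar> = 9 * \<bar>3 * u - 1\<bar>" by (simp add: abs_if)
    ultimately have "9 * \<bar>3 * u - 1\<bar> \<le> 8 * \<bar>y0 - y1\<bar>" "\<bar>3 * x + 1\<bar> \<le> 2 * \<bar>3 * u - 1\<bar>"
      by simp_all
    then have gap: "\<bar>3 * x + 1\<bar> \<le> 2 * \<bar>y0 - y1\<bar>" by argo
    \<comment> \<open>Of the two lower curves, \<open>a\<close> is the higher one; the distance from
      y to the other is at least the gap between them.\<close>
    have "\<bar>y0 - y1\<bar> * (y - a) \<le> (y - y0) * (y - y1)"
    proof (cases "y0 \<le> y1")
      case True
      then have "(y1 - y0) * (y - y1) \<le> (y - y0) * (y - y1)"
        using y by (intro mult_right_mono) auto
      with True show ?thesis by (simp add: a_def)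
    next
      case False
      then have "(y0 - y1) * (y - y0) \<le> (y - y1) * (y - y0)"
        using y by (intro mult_right_mono) auto
      with False show ?thesis by (simp add: a_def mult.commute)
    qed
    then have le: "(c - y) * (2 * (\<bar>y0 - y1\<bar> * (y - a))) \<le> (c - y) * (2 * ((y - y0) * (y - y1)))"
      using y by (intro mult_left_mono) auto
    have "\<bar>3 * x + 1\<bar> * ((y - a) * (c - y)) \<le> 2 * \<bar>y0 - y1\<bar> * ((y - a) * (c - y))"
      using gap y by (intro mult_right_mono mult_nonneg_nonneg) (auto simp: a_def)
    also have "\<dots> = (c - y) * (2 * (\<bar>y0 - y1\<bar> * (y - a)))" by (simp only: mult_ac)
    also note le
    also have "(c - y) * (2 * ((y - y0) * (y - y1))) = parab x y * cubic x y"
      unfolding p q by (simp only: mult_ac)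
    finally show ?thesis using y by (simp add: a_def)
  qed
  then show ?thesis by (rule that)
qed

section \<open>Measurability of the weight and domination by the case of exponents -1/2\<close>

lemma open_region: "open region"
  unfolding region_def parab_def cubic_def case_prod_beta
  by (intro open_Collect_conj open_Collect_less continuous_intros)

lemma borel_region [measurable]: "region \<in> sets borel"
  using open_region by simp

lemma borel_measurable_parab [measurable]: "(\<lambda>z. parab (fst z) (snd z)) \<in> borel_measurable borel"
  unfolding parab_def by (intro borel_measurable_continuous_onI continuous_intros)

lemma borel_measurable_cubic [measurable]: "(\<lambda>z. cubic (fst z) (snd z)) \<in> borel_measurable borel"
  unfolding cubic_def by (intro borel_measurable_continuous_onI continuous_intros)

definition power_weight :: "real \<Rightarrow> real \<Rightarrow> real \<times> real \<Rightarrow> real" where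
  "power_weight \<alpha> \<beta> z = indicator region z *
     (parab (fst z) (snd z) powr \<alpha> * cubic (fst z) (snd z) powr \<beta>)"

lemma power_weight_nonneg: "0 \<le> power_weight \<alpha> \<beta> z"
  by (simp add: power_weight_def)

lemma borel_measurable_power_weight [measurable]:
  "power_weight \<alpha> \<beta> \<in> borel_measurable borel"
  unfolding power_weight_def[abs_def] by measurable

lemma powr_neg_half: "0 < t \<Longrightarrow> t powr (- (1 / 2)) = 1 / sqrt (t :: real)"
  using powr_minus_divide[of t "1 / 2"] by (simp add: powr_half_sqrt)

lemma nn_integral_power_weight_half:
  "(\<integral>\<^sup>+ z. ennreal (power_weight (- 1 / 2) (- 1 / 2) z) \<partial>lborel) < \<infinity>"
proof -
  let ?w = "power_weight (- 1 / 2) (- 1 / 2)"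
  \<comment> \<open>At x = -1/3 the right-hand side is 0 by the convention for division by zero, so
    this single value is left out.\<close>
  have slice: "(\<integral>\<^sup>+ y. ennreal (?w (x, y)) \<partial>lborel)
      \<le> ennreal (pi / sqrt \<bar>3 * x + 1\<bar>) * indicator {- 1..1} x" if "x \<noteq> - 1 / 3" for x
  proof (cases "\<exists>y. (x, y) \<in> region")
    case False
    then show ?thesis by (simp add: power_weight_def)
  next
    case True
    obtain a c where ac: "\<And>y. (x, y) \<in> region \<Longrightarrow> a < y \<and> y < c \<and>
        \<bar>3 * x + 1\<bar> * ((y - a) * (c - y)) \<le> parab x y * cubic x y"
      using region_slice[of x] by blast
    have x: "x \<in> {- 1..1}" and "a < c"
      using True ac region_bounded by force+
    have k: "0 < \<bar>3 * x + 1\<bar>" using that by (simp add: field_simps)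
    have le: "ennreal (?w (x, y)) \<le> ennreal (1 / sqrt \<bar>3 * x + 1\<bar>) *
        (ennreal (1 / sqrt ((y - a) * (c - y))) * indicator {a..c} y)" for y
    proof (cases "(x, y) \<in> region")
      case False
      then show ?thesis by (simp add: power_weight_def)
    next
      case R: True
      have y: "a < y" "y < c" using ac[OF R] by auto
      have pos: "0 < parab x y" "0 < cubic x y" using R by (auto simp: region_def)
      have "?w (x, y) = 1 / sqrt (parab x y * cubic x y)"
        using R pos by (simp add: power_weight_def powr_neg_half real_sqrt_mult)
      also have "\<dots> \<le> 1 / sqrt (\<bar>3 * x + 1\<bar> * ((y - a) * (c - y)))"
        using ac[OF R] k y pos
        by (intro divide_left_mono real_sqrt_le_mono mult_pos_pos) auto
      also have "\<dots> = 1 / sqrt \<bar>3 * x + 1\<bar> * (1 / sqrt ((y - a) * (c - y)))"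
        by (simp add: real_sqrt_mult)
      finally have "ennreal (?w (x, y)) \<le>
          ennreal (1 / sqrt \<bar>3 * x + 1\<bar> * (1 / sqrt ((y - a) * (c - y))))"
        by (rule ennreal_leI)
      also have "\<dots> = ennreal (1 / sqrt \<bar>3 * x + 1\<bar>) * ennreal (1 / sqrt ((y - a) * (c - y)))"
        using y by (intro ennreal_mult) auto
      finally show ?thesis using y by simp
    qed
    have "(\<integral>\<^sup>+ y. ennreal (?w (x, y)) \<partial>lborel) \<le> (\<integral>\<^sup>+ y. ennreal (1 / sqrt \<bar>3 * x + 1\<bar>) *
        (ennreal (1 / sqrt ((y - a) * (c - y))) * indicator {a..c} y) \<partial>lborel)"
      by (intro nn_integral_mono le)
    also have "\<dots> = ennreal (1 / sqrt \<bar>3 * x + 1\<bar>) * ennreal pi"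
      by (subst nn_integral_cmult) (simp_all add: nn_integral_arcsin_density[OF \<open>a < c\<close>])
    also have "\<dots> = ennreal (pi / sqrt \<bar>3 * x + 1\<bar>) * indicator {- 1..1} x"
      using x by (simp add: ennreal_mult[symmetric])
    finally show ?thesis .
  qed
  have "(\<integral>\<^sup>+ z. ennreal (?w z) \<partial>lborel) = (\<integral>\<^sup>+ x. \<integral>\<^sup>+ y. ennreal (?w (x, y)) \<partial>lborel \<partial>lborel)"
    unfolding lborel_prod[symmetric]
    by (subst lborel.nn_integral_fst) (simp_all add: lborel_prod)
  also have "\<dots> \<le> (\<integral>\<^sup>+ x. ennreal (pi / sqrt \<bar>3 * x + 1\<bar>) * indicator {- 1..1} x \<partial>lborel)"
    using slice AE_lborel_singleton[of "- 1 / 3 :: real"]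
    by (intro nn_integral_mono_AE) (auto elim!: eventually_mono)
  also have "\<dots> < \<infinity>" by (rule nn_integral_inverse_sqrt_finite)
  finally show ?thesis .
qed

text \<open>Reduces every admissible exponent to the worst one, -1/2. The number 81 is a crude
  common upper bound of \<open>parab\<close> and \<open>cubic\<close> on the region.\<close>

lemma powr_le_powr_neg_half:
  fixes t \<gamma> :: real
  assumes "0 < t" "t \<le> 81" "- 1 / 2 \<le> \<gamma>"
  shows "t powr \<gamma> \<le> 81 powr (\<gamma> + 1 / 2) * t powr (- 1 / 2)"
proof -
  have "t powr \<gamma> = t powr (\<gamma> + 1 / 2) * t powr (- 1 / 2)"
    by (simp add: powr_add[symmetric])
  also have "\<dots> \<le> 81 powr (\<gamma> + 1 / 2) * t powr (- 1 / 2)"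
    using assms by (intro mult_right_mono powr_mono2) auto
  finally show ?thesis .
qed

lemma integrable_power_weight:
  assumes "- 1 / 2 \<le> \<alpha>" "- 1 / 2 \<le> \<beta>"
  shows "integrable lborel (power_weight \<alpha> \<beta>)"
proof (rule Bochner_Integration.integrable_bound)
  let ?K = "81 powr (\<alpha> + 1 / 2) * 81 powr (\<beta> + 1 / 2)"
  let ?w = "power_weight (- 1 / 2) (- 1 / 2)"
  have "integrable lborel ?w"
    using nn_integral_power_weight_half
    by (intro integrableI_nonneg) (auto simp: power_weight_nonneg)
  then show "integrable lborel (\<lambda>z. ?K * ?w z)" by simp
  have "power_weight \<alpha> \<beta> z \<le> ?K * ?w z" for z
  proof (cases "z \<in> region")
    case True
    obtain x y where z: "z = (x, y)" by force
    have pos: "0 < parab x y" "0 < cubic x y"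
      using True by (auto simp: region_def z)
    have "(x, y) \<in> {- 1..1} \<times> {- 1..1}" using True region_bounded unfolding z by blast
    then have xy: "\<bar>x\<bar> \<le> 1" "\<bar>y\<bar> \<le> 1" by (auto simp: abs_le_iff)
    have "parab x y \<le> 81"
      using xy zero_le_power2[of x] unfolding parab_def by linarith
    moreover have "cubic x y \<le> 81"
    proof -
      have "x * y \<ge> - 1" "x ^ 3 \<le> 1"
        using xy abs_mult[of x y] mult_mono[of "\<bar>x\<bar>" 1 "\<bar>y\<bar>" 1] power_le_one[of "\<bar>x\<bar>" 3]
          abs_ge_self[of "x ^ 3"] by (auto simp: power_abs)
      then show ?thesis
        using xy zero_le_power2[of y] unfolding cubic_def mult.assoc by linarith
    qed
    ultimately have "parab x y powr \<alpha> * cubic x y powr \<beta> \<le>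
        (81 powr (\<alpha> + 1 / 2) * parab x y powr (- 1 / 2)) *
        (81 powr (\<beta> + 1 / 2) * cubic x y powr (- 1 / 2))"
      using pos assms by (intro mult_mono powr_le_powr_neg_half) auto
    then show ?thesis using True by (simp add: power_weight_def z mult_ac)
  qed (simp add: power_weight_def)
  then show "AE z in lborel. norm (power_weight \<alpha> \<beta> z) \<le> norm (?K * ?w z)"
    by (simp add: power_weight_nonneg abs_mult)
qed simp

section \<open>Derivations of bivariate polynomials\<close>

lemma dx_pCons: "dx (pCons a p) = pCons (pderiv a) (dx p)"
  by (cases "a = 0 \<and> p = 0") (auto simp: dx_def map_poly_pCons)

lemma dx_0 [simp]: "dx 0 = 0"
  by (simp add: dx_def)

lemma dx_add: "dx (p + q) = dx p + dx q"
  by (intro poly_eqI) (simp add: dx_def coeff_map_poly pderiv_add)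

lemma dx_smult: "dx (smult a p) = smult (pderiv a) p + smult a (dx p)"
  by (intro poly_eqI) (simp add: dx_def coeff_map_poly pderiv_mult mult.commute)

lemma dx_mult: "dx (p * q) = dx p * q + p * dx q"
  by (induction p) (simp_all add: dx_pCons dx_add dx_smult add_ac)

lemma dx_minus: "dx (- p) = - dx p"
  by (intro poly_eqI) (simp add: dx_def coeff_map_poly pderiv_minus)

lemma dx_diff: "dx (p - q) = dx p - dx q"
  by (intro poly_eqI) (simp add: dx_def coeff_map_poly pderiv_diff)

lemma dx_const: "dx [:[:c:]:] = 0"
  by (simp add: dx_pCons)

lemma dx_numeral: "dx (numeral n) = 0"
  by (metis dx_const numeral_poly)

lemma dx_polyX: "dx polyX = 1" and dx_polyY: "dx polyY = 0"
  by (simp_all add: polyX_def polyY_def dx_pCons pderiv_pCons one_pCons)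

lemma dy_add: "dy (p + q) = dy p + dy q"
  by (simp add: dy_def pderiv_add)

lemma dy_diff: "dy (p - q) = dy p - dy q"
  by (simp add: dy_def pderiv_diff)

lemma dy_minus: "dy (- p) = - dy p"
  by (simp add: dy_def pderiv_minus)

lemma dy_mult: "dy (p * q) = dy p * q + p * dy q"
  by (simp add: dy_def pderiv_mult mult.commute)

lemma dy_numeral: "dy (numeral n) = 0"
  by (metis dy_def numeral_poly pderiv_singleton)

lemma dy_polyX: "dy polyX = 0" and dy_polyY: "dy polyY = 1"
  by (simp_all add: polyX_def polyY_def dy_def pderiv_pCons one_pCons)

lemma dx_dy: "dx (dy p) = dy (dx p)"
  by (intro poly_eqI)
    (simp add: dx_def dy_def coeff_map_poly coeff_pderiv of_nat_poly pderiv_smult del: of_nat_Suc)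

lemmas deriv_simps = dx_add dx_diff dx_minus dx_mult dx_numeral dx_polyX dx_polyY
  dy_add dy_diff dy_minus dy_mult dy_numeral dy_polyX dy_polyY dx_dy

text \<open>The factors of \<alpha> and \<beta> are the derivatives of the logarithms of parab and cubic along the field
  under the divergence.\<close>

lemma L_op_lagrange:
  fixes f g :: bipoly
  defines "D1 \<equiv> dx f * g - f * dx g" and "D2 \<equiv> dy f * g - f * dy g"
  shows "L_op \<alpha> \<beta> f * g - f * L_op \<alpha> \<beta> g =
    - (dx (A11 * D1 + A12 * D2) + dy (A12 * D1 + A22 * D2)
       + cst \<alpha> * (- (12 * polyX + 6) * D1 - (36 * polyX + 18 * polyY) * D2)
       + cst \<beta> * (- (18 * polyX) * D1 - (18 + 36 * polyY) * D2))"
  unfolding L_op_def D1_def D2_def A11_def A12_def A22_def B1_def B2_def power2_eq_square power3_eq_cube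
  by (simp add: deriv_simps) (simp add: algebra_simps)


section \<open>Products and derivatives of monomials\<close>

lemma scale_mult_left: "scale c p * q = scale c (p * q)" and scale_mult_right: "p * scale c q = scale c (p * q)"
  by (simp_all add: scale_def)

lemma dx_scale: "dx (scale c p) = scale c (dx p)"
  by (simp add: scale_def dx_smult)

lemma dy_scale: "dy (scale c p) = scale c (dy p)"
  by (simp add: scale_def dy_def pderiv_smult)

lemma numeral_mult_eq_scale: "numeral n * p = scale (numeral n) p"
  by (simp add: scale_def numeral_poly)

lemma cst_mult_eq_scale: "cst c * p = scale (of_real c) p"
  by (simp add: scale_def cst_def)

lemma polyX_mon: "polyX * mon (j, k) = mon (Suc j, k)"
  by (simp add: mon_def mult_ac)

lemma polyY_mon: "polyY * mon (j, k) = mon (j, Suc k)"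
  by (simp add: mon_def mult_ac)

lemma dy_mon: "dy (mon (j, k)) = scale (of_nat k) (mon (j, k - 1))"
  by (rule poly_eqI, rule poly_eqI)
    (auto simp: dy_def scale_def coeff_pderiv coeff_mon of_nat_poly simp del: of_nat_Suc)

lemma L_op_add: "L_op \<alpha> \<beta> (p + q) = L_op \<alpha> \<beta> p + L_op \<alpha> \<beta> q"
  by (simp add: L_op_def dx_add dy_add algebra_simps)

lemma L_op_scale: "L_op \<alpha> \<beta> (scale c p) = scale c (L_op \<alpha> \<beta> p)"
  by (simp add: L_op_def dx_scale dy_scale scale_mult_right bipoly.scale_right_distrib
      bipoly.scale_right_diff_distrib)

section \<open>The star-order and triangularity\<close>

lemma star_less_iff:
  "k \<prec>\<^sub>* j \<longleftrightarrow> star_deg k < star_deg j \<or> star_deg k = star_deg j \<and> snd k < snd j"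
  unfolding star_less_def star_deg_def by auto

lemma star_less_trans: "i \<prec>\<^sub>* j \<Longrightarrow> j \<prec>\<^sub>* k \<Longrightarrow> i \<prec>\<^sub>* k"
  by (auto simp: star_less_iff)

lemma star_less_irrefl: "\<not> k \<prec>\<^sub>* k"
  by (simp add: star_less_iff)

lemma star_less_linear: "k \<prec>\<^sub>* j \<or> k = j \<or> j \<prec>\<^sub>* k"
  by (cases k; cases j) (auto simp: star_less_iff star_deg_def)

lemma finite_star_less: "finite {k. k \<prec>\<^sub>* j}"
  using finite_star_le[of j] by (rule finite_subset[rotated]) (auto simp: star_le_def)

text \<open>Initial segments are finite, so the number of predecessors is a measure.\<close>

lemma wf_star_less: "wfP (\<prec>\<^sub>*)"
proof -
  have "card {i. i \<prec>\<^sub>* k} < card {i. i \<prec>\<^sub>* j}" if "k \<prec>\<^sub>* j" for k j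
  proof (intro psubset_card_mono finite_star_less psubsetI)
    show "{i. i \<prec>\<^sub>* k} \<subseteq> {i. i \<prec>\<^sub>* j}" using that by (auto intro: star_less_trans)
    show "{i. i \<prec>\<^sub>* k} \<noteq> {i. i \<prec>\<^sub>* j}" using that star_less_irrefl[of k] by blast
  qed
  then show ?thesis by (rule wfp_if_convertible_to_nat)
qed

text \<open>The strict counterpart of \<open>Pi_star\<close>: having leading term
  \<open>mon k\<close> amounts to \<open>p - mon k \<in> below k\<close>, the form in which it is
  used throughout.\<close>

definition below :: "nat \<times> nat \<Rightarrow> bipoly set" where
  "below k = bipoly.span (mon ` {j. j \<prec>\<^sub>* k})"

lemma mon_in_below: "j \<prec>\<^sub>* k \<Longrightarrow> mon j \<in> below k"
  unfolding below_def by (intro bipoly.span_base) auto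

lemma below_mono: "j \<prec>\<^sub>* k \<Longrightarrow> below j \<subseteq> below k"
  unfolding below_def by (intro bipoly.span_mono image_mono) (auto intro: star_less_trans)

lemma inj_mon: "inj mon"
proof (rule injI)
  fix j k assume "mon j = mon k"
  then have "coeff (coeff (mon j) (snd k)) (fst k) = coeff (coeff (mon k) (snd k)) (fst k)" by simp
  then show "j = k" by (cases j; cases k) (simp add: coeff_mon split: if_splits)
qed

lemma below_add: "p \<in> below k \<Longrightarrow> q \<in> below k \<Longrightarrow> p + q \<in> below k"
  unfolding below_def by (rule bipoly.span_add)

lemma below_diff: "p \<in> below k \<Longrightarrow> q \<in> below k \<Longrightarrow> p - q \<in> below k"
  unfolding below_def by (rule bipoly.span_diff)

lemma below_scale: "p \<in> below k \<Longrightarrow> scale c p \<in> below k"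
  unfolding below_def by (rule bipoly.span_scale)

lemma scale_mon_in_below: "c = 0 \<or> j \<prec>\<^sub>* k \<Longrightarrow> scale c (mon j) \<in> below k"
proof (elim disjE)
  assume "c = 0"
  then show ?thesis by (simp add: below_def bipoly.span_zero)
qed (intro below_scale mon_in_below)

lemma below_numeral: "p \<in> below k \<Longrightarrow> numeral n * p \<in> below k"
  unfolding numeral_mult_eq_scale by (rule below_scale)

lemma below_cst: "p \<in> below k \<Longrightarrow> cst c * p \<in> below k"
  unfolding cst_mult_eq_scale by (rule below_scale)

text \<open>Each term of the operator shifts the exponent by a fixed vector. The terms that keep the
  exponent add up to the eigenvalue, and all others lower \<open>star_deg\<close>, except the x^3
  term of \<open>A22\<close>: it keeps \<open>star_deg\<close> and lowers the second exponent by 2,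
  so that the tie-break of the order is needed.\<close>

lemma L_op_mon: "L_op \<alpha> \<beta> (mon k) - scale (of_real (eigenval \<alpha> \<beta> k)) (mon k) \<in> below k"
proof -
  obtain a b where k: "k = (a, b)" by force
  define m where "m = mon (a, b)"
  \<comment> \<open>Whenever a subtraction is truncated at 0, the numerical factor in front
    vanishes; this is the alternative \<open>c = 0\<close> of
    \<open>scale_mon_in_below\<close>.\<close>
  define Txx where "Txx = scale (of_nat a * of_nat (a - 1)) (mon (a - 1 - 1, b))"
  define Txy where "Txy = scale (of_nat a * of_nat b) (mon (a - 1, b - 1))"
  define Tyy where "Tyy = scale (of_nat b * of_nat (b - 1)) (mon (a, b - 1 - 1))"
  define Tx where "Tx = scale (of_nat a) (mon (a - 1, b))"
  define Ty where "Ty = scale (of_nat b) (mon (a, b - 1))"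
  note T = Txx_def Txy_def Tyy_def Tx_def Ty_def
  have derivs: "dx m = Tx" "dy m = Ty" "dx Tx = Txx" "dx Ty = Txy" "dy Ty = Tyy"
    by (simp_all add: m_def T dx_mon dy_mon dx_scale dy_scale mult.commute)
  have principal:
    "polyX * (polyX * Txx) = scale (of_nat a * (of_nat a - 1)) m"
    "polyX * (polyY * Txy) = scale (of_nat a * of_nat b) m"
    "polyY * (polyY * Tyy) = scale (of_nat b * (of_nat b - 1)) m"
    "polyX * Tx = scale (of_nat a) m" "polyY * Ty = scale (of_nat b) m"
    by (cases a; cases "a - 1"; cases b; cases "b - 1";
        simp add: T m_def scale_mult_right polyX_mon polyY_mon)+
  have lower:
    "polyY * Txx \<in> below k" "polyX * Txx \<in> below k" "Txx \<in> below k"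
    "polyX * (polyX * Txy) \<in> below k" "polyY * Txy \<in> below k" "Txy \<in> below k"
    "polyX * (polyX * (polyX * Tyy)) \<in> below k" "polyX * (polyY * Tyy) \<in> below k"
    "polyX * Tyy \<in> below k" "polyY * Tyy \<in> below k"
    "Tx \<in> below k" "polyX * Ty \<in> below k" "Ty \<in> below k"
    unfolding T scale_mult_right polyX_mon polyY_mon k
    by (rule scale_mon_in_below; auto simp: star_less_iff star_deg_def)+
  define R where "R =
      2 * (6 * (polyY * Txy) + 3 * Txy - 18 * (polyX * (polyX * Txy)))
      + (54 * (polyX * (polyY * Tyy)) + 27 * (polyX * Tyy) + 9 * (polyY * Tyy)
         - 108 * (polyX * (polyX * (polyX * Tyy))))
      + (6 * (cst \<alpha> * Tx) + 3 * Tx)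
      + (18 * (polyX * Ty) + 36 * (cst \<alpha> * (polyX * Ty)) + 18 * (cst \<beta> * Ty) + 9 * Ty)
      - (polyY * Txx + 3 * (polyX * Txx) + 2 * Txx)"
  have "R \<in> below k"
    unfolding R_def by (intro below_add below_diff below_numeral below_cst lower)
  moreover have "L_op \<alpha> \<beta> m = R + (6 * (polyX * (polyX * Txx)) + 18 * (polyX * (polyY * Txy))
      + 18 * (polyY * (polyY * Tyy))
      + (21 * (polyX * Tx) + 12 * (cst \<alpha> * (polyX * Tx)) + 18 * (cst \<beta> * (polyX * Tx)))
      + (45 * (polyY * Ty) + 36 * (cst \<beta> * (polyY * Ty)) + 18 * (cst \<alpha> * (polyY * Ty))))"
    unfolding L_op_def derivs R_def A11_def A12_def A22_def B1_def B2_def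
    by (simp add: algebra_simps power2_eq_square power3_eq_cube)
  moreover have "6 * (polyX * (polyX * Txx)) + 18 * (polyX * (polyY * Txy))
      + 18 * (polyY * (polyY * Tyy))
      + (21 * (polyX * Tx) + 12 * (cst \<alpha> * (polyX * Tx)) + 18 * (cst \<beta> * (polyX * Tx)))
      + (45 * (polyY * Ty) + 36 * (cst \<beta> * (polyY * Ty)) + 18 * (cst \<alpha> * (polyY * Ty)))
      = scale (of_real (eigenval \<alpha> \<beta> k)) m"
  proof -
    have "complex_of_real (eigenval \<alpha> \<beta> k) =
        6 * (of_nat a * (of_nat a - 1)) + 18 * (of_nat a * of_nat b) + 18 * (of_nat b * (of_nat b - 1))
        + (21 * of_nat a + 12 * (of_real \<alpha> * of_nat a) + 18 * (of_real \<beta> * of_nat a))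
        + (45 * of_nat b + 36 * (of_real \<beta> * of_nat b) + 18 * (of_real \<alpha> * of_nat b))"
      by (simp add: eigenval_def star_deg_def k field_simps)
    then show ?thesis
      unfolding principal numeral_mult_eq_scale cst_mult_eq_scale bipoly.scale_scale
      by (simp add: bipoly.scale_left_distrib)
  qed
  ultimately show ?thesis by (simp add: k m_def)
qed

lemma L_op_below: "q \<in> below k \<Longrightarrow> L_op \<alpha> \<beta> q \<in> below k"
  unfolding below_def
proof (induction rule: bipoly.span_induct_alt)
  case base
  then show ?case using L_op_scale[of \<alpha> \<beta> 0 0] by (simp add: bipoly.span_zero)
next
  case (step c b q)
  then obtain j where j: "b = mon j" "j \<prec>\<^sub>* k" by auto
  have "(L_op \<alpha> \<beta> b - scale (of_real (eigenval \<alpha> \<beta> j)) b) + scale (of_real (eigenval \<alpha> \<beta> j)) b \<in> below k"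
    unfolding j(1) using below_mono[OF j(2)] mon_in_below[OF j(2)]
    by (intro below_add below_scale subsetD[OF _ L_op_mon])
  then show ?case
    using step by (simp add: L_op_add L_op_scale below_def bipoly.span_add bipoly.span_scale)
qed

section \<open>Integration by parts\<close>

lemma eval2_pCons: "eval2 (pCons a p) x y = poly a (complex_of_real x) + complex_of_real y * eval2 p x y"
  by (simp add: eval2_def)

lemma eval2_0 [simp]: "eval2 0 x y = 0"
  by (simp add: eval2_def)

lemma eval2_1 [simp]: "eval2 1 x y = 1"
  by (simp add: eval2_def)

lemma eval2_numeral [simp]: "eval2 (numeral n) x y = numeral n"
  by (simp add: eval2_def)

lemma eval2_add [simp]: "eval2 (p + q) x y = eval2 p x y + eval2 q x y"
  by (simp add: eval2_def)

lemma eval2_diff [simp]: "eval2 (p - q) x y = eval2 p x y - eval2 q x y"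
  by (simp add: eval2_def)

lemma eval2_minus [simp]: "eval2 (- p) x y = - eval2 p x y"
  by (simp add: eval2_def)

lemma eval2_mult [simp]: "eval2 (p * q) x y = eval2 p x y * eval2 q x y"
  by (simp add: eval2_def)

lemma eval2_power [simp]: "eval2 (p ^ n) x y = eval2 p x y ^ n"
  by (simp add: eval2_def poly_power)

lemma eval2_polyX [simp]: "eval2 polyX x y = complex_of_real x"
  by (simp add: eval2_def polyX_def)

lemma eval2_polyY [simp]: "eval2 polyY x y = complex_of_real y"
  by (simp add: eval2_def polyY_def)

lemma eval2_cst [simp]: "eval2 (cst c) x y = complex_of_real c"
  by (simp add: eval2_def cst_def)

lemma eval2_scale [simp]: "eval2 (scale c p) x y = c * eval2 p x y"
  by (simp add: eval2_def scale_def)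

lemma eval2_has_dx:
  "((\<lambda>x. eval2 p x y) has_vector_derivative eval2 (dx p) x y) (at x within S)"
proof (induction p)
  case (pCons a p)
  have "((\<lambda>x. poly a (complex_of_real x)) has_vector_derivative
      poly (pderiv a) (complex_of_real x)) (at x within S)"
    by (intro has_vector_derivative_real_field poly_DERIV)
  then show ?case
    unfolding eval2_pCons dx_pCons
    by (intro has_vector_derivative_add has_vector_derivative_mult_right pCons.IH)
qed (simp add: dx_def)

lemma eval2_has_dy:
  "((\<lambda>y. eval2 p x y) has_vector_derivative eval2 (dy p) x y) (at y within S)"
proof (induction p)
  case (pCons a p)
  have "((\<lambda>y. complex_of_real y) has_vector_derivative 1) (at y within S)"
    by (auto intro!: derivative_eq_intros)
  from has_vector_derivative_mult[OF this pCons.IH]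
  have "((\<lambda>y. poly a (complex_of_real x) + complex_of_real y * eval2 p x y) has_vector_derivative
      0 + (complex_of_real y * eval2 (dy p) x y + 1 * eval2 p x y)) (at y within S)"
    by (intro has_vector_derivative_add has_vector_derivative_const)
  then show ?case
    by (simp add: eval2_pCons dy_def pderiv_pCons add.commute)
qed (simp add: dy_def)

lemma continuous_on_eval2: "continuous_on S (\<lambda>z. eval2 p (fst z) (snd z))"
proof (induction p)
  case (pCons a p)
  then show ?case unfolding eval2_pCons by (intro continuous_intros)
qed simp

lemma borel_measurable_eval2 [measurable]: "(\<lambda>z. eval2 p (fst z) (snd z)) \<in> borel_measurable borel"
  by (intro borel_measurable_continuous_onI continuous_on_eval2)

lemma eval2_bounded_on_region:
  obtains M where "0 \<le> M" "\<And>z. z \<in> region \<Longrightarrow> norm (eval2 p (fst z) (snd z)) \<le> M"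
proof -
  have "compact ((\<lambda>z. eval2 p (fst z) (snd z)) ` ({- 1..1} \<times> {- 1..1}))"
    by (intro compact_continuous_image continuous_on_eval2 compact_Times compact_Icc)
  then have "bounded ((\<lambda>z. eval2 p (fst z) (snd z)) ` ({- 1..1} \<times> {- 1..1}))"
    by (rule compact_imp_bounded)
  then obtain M where "0 < M" "\<forall>w\<in>(\<lambda>z. eval2 p (fst z) (snd z)) ` ({- 1..1} \<times> {- 1..1}). norm w \<le> M"
    unfolding bounded_pos by blast
  moreover have "fst z \<in> {- 1..1} \<and> snd z \<in> {- 1..1}" if "z \<in> region" for z
    using that region_bounded by (auto simp: mem_Times_iff dest!: subsetD)
  ultimately show ?thesis
    by (intro that[of M]) (auto simp: image_iff mem_Times_iff)
qed

lemma integrable_power_weight_eval2: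
  assumes "- 1 / 2 \<le> \<alpha>" "- 1 / 2 \<le> \<beta>"
  shows "integrable lborel (\<lambda>z. complex_of_real (power_weight \<alpha> \<beta> z) * eval2 p (fst z) (snd z))"
proof -
  obtain M where M: "0 \<le> M" "\<And>z. z \<in> region \<Longrightarrow> norm (eval2 p (fst z) (snd z)) \<le> M"
    using eval2_bounded_on_region[of p] by blast
  show ?thesis
  proof (rule Bochner_Integration.integrable_bound)
    show "integrable lborel (\<lambda>z. M * power_weight \<alpha> \<beta> z)"
      using integrable_power_weight[OF assms] by simp
    have "norm (complex_of_real (power_weight \<alpha> \<beta> z) * eval2 p (fst z) (snd z))
        \<le> M * power_weight \<alpha> \<beta> z" for z
    proof (cases "z \<in> region")
      case True
      then have "power_weight \<alpha> \<beta> z * norm (eval2 p (fst z) (snd z)) \<le> power_weight \<alpha> \<beta> z * M"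
        by (intro mult_left_mono M power_weight_nonneg)
      then show ?thesis by (simp add: norm_mult power_weight_nonneg mult.commute)
    qed (simp add: power_weight_def)
    then show "AE z in lborel. norm (complex_of_real (power_weight \<alpha> \<beta> z) * eval2 p (fst z) (snd z))
        \<le> norm (M * power_weight \<alpha> \<beta> z)"
      using M(1) by (simp add: power_weight_nonneg)
  qed simp
qed

text \<open>The weight may be unbounded at the boundary, so each power t powr g is replaced by
  t powr (g + 2) / (t^2 + e), which extends continuously differentiably by 0 to t \<le> 0. As e tends to 0,
  t times its derivative converges boundedly, relative to t powr g, to g * t powr g; for a tangent field
  the derivative of the weight occurs only in this combination.\<close>

definition pos_powr :: "real \<Rightarrow> real \<Rightarrow> real" where
  "pos_powr b t = max 0 t powr b"

lemma continuous_on_pos_powr [continuous_intros]: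
  assumes "0 < b" "continuous_on S f"
  shows "continuous_on S (\<lambda>x. pos_powr b (f x))"
  unfolding pos_powr_def using assms by (intro continuous_on_powr' continuous_intros) auto

lemma pos_powr_has_derivative:
  assumes "1 < b"
  shows "(pos_powr b has_real_derivative b * pos_powr (b - 1) t) (at t)"
proof -
  consider "0 < t" | "t < 0" | "t = 0" by linarith
  then show ?thesis
  proof cases
    case 1
    have "((\<lambda>t. t powr b) has_real_derivative b * pos_powr (b - 1) t) (at t)"
      using has_real_derivative_powr[OF 1, of b] 1 by (simp add: pos_powr_def)
    then show ?thesis
      by (rule has_field_derivative_transform_within_open[where S = "{0<..}"])
        (use 1 in \<open>auto simp: pos_powr_def\<close>)
  next
    case 2
    have "((\<lambda>t. 0) has_real_derivative b * pos_powr (b - 1) t) (at t)"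
      using 2 by (simp add: pos_powr_def)
    then show ?thesis
      by (rule has_field_derivative_transform_within_open[where S = "{..<0}"])
        (use 2 in \<open>auto simp: pos_powr_def\<close>)
  next
    case 3
    \<comment> \<open>The difference quotient at 0 is dominated by |h|^(b - 1), which tends to 0
      because b > 1.\<close>
    have "continuous_on UNIV (\<lambda>h. pos_powr (b - 1) \<bar>h\<bar>)"
      using assms by (intro continuous_intros) auto
    then have "((\<lambda>h. pos_powr (b - 1) \<bar>h\<bar>) \<longlongrightarrow> 0) (at 0)"
      by (simp add: continuous_on_def pos_powr_def) (metis abs_zero max.idem powr_0 powr_zero_eq_one zero_neq_one powr_eq_0_iff)
    moreover have "norm (pos_powr b h / h) \<le> pos_powr (b - 1) \<bar>h\<bar>" for h
      by (cases "0 < h") (auto simp: pos_powr_def powr_diff divide_nonneg_nonpos)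
    then have "\<forall>\<^sub>F h in at 0. norm (pos_powr b h / h) \<le> pos_powr (b - 1) \<bar>h\<bar>"
      by (intro always_eventually allI)
    ultimately have "((\<lambda>h. pos_powr b h / h) \<longlongrightarrow> 0) (at 0)"
      by (rule Lim_null_comparison[rotated])
    then show ?thesis
      unfolding 3 by (simp add: DERIV_def pos_powr_def)
  qed
qed

definition cutoff :: "real \<Rightarrow> real \<Rightarrow> real \<Rightarrow> real" where
  "cutoff \<gamma> e t = pos_powr (\<gamma> + 2) t / (t\<^sup>2 + e)"

definition cutoff_deriv :: "real \<Rightarrow> real \<Rightarrow> real \<Rightarrow> real" where
  "cutoff_deriv \<gamma> e t =
     (\<gamma> + 2) * pos_powr (\<gamma> + 1) t / (t\<^sup>2 + e) - 2 * t * pos_powr (\<gamma> + 2) t / (t\<^sup>2 + e)\<^sup>2"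

text \<open>From \<gamma> \<ge> -1/2 it follows that \<gamma> + 2 > 1 and \<gamma> + 1 > 0, so the
  numerator is continuously differentiable across t = 0.\<close>

lemma cutoff_has_derivative:
  assumes "- 1 / 2 \<le> \<gamma>" "0 < e"
  shows "(cutoff \<gamma> e has_real_derivative cutoff_deriv \<gamma> e t) (at t)"
proof -
  have nz: "t\<^sup>2 + e \<noteq> 0" using assms zero_le_power2[of t] by linarith
  have den: "((\<lambda>t. t\<^sup>2 + e) has_real_derivative 2 * t) (at t)"
    by (auto intro!: derivative_eq_intros)
  have num: "(pos_powr (\<gamma> + 2) has_real_derivative (\<gamma> + 2) * pos_powr (\<gamma> + 1) t) (at t)"
    using pos_powr_has_derivative[of "\<gamma> + 2" t] assms by (simp add: add.commute)
  have "(cutoff \<gamma> e has_real_derivative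
     ((\<gamma> + 2) * pos_powr (\<gamma> + 1) t * (t\<^sup>2 + e) - pos_powr (\<gamma> + 2) t * (2 * t)) /
       ((t\<^sup>2 + e) * (t\<^sup>2 + e))) (at t)"
    unfolding cutoff_def[abs_def] using DERIV_quotient[OF num den nz] by (simp add: mult_ac)
  also have "((\<gamma> + 2) * pos_powr (\<gamma> + 1) t * (t\<^sup>2 + e) - pos_powr (\<gamma> + 2) t * (2 * t)) /
       ((t\<^sup>2 + e) * (t\<^sup>2 + e)) = cutoff_deriv \<gamma> e t"
    using nz by (simp add: cutoff_deriv_def diff_divide_distrib power2_eq_square mult_ac)
  finally show ?thesis .
qed

lemma continuous_on_cutoff [continuous_intros]:
  assumes "- 1 / 2 \<le> \<gamma>" "0 < e" "continuous_on S f"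
  shows "continuous_on S (\<lambda>x. cutoff \<gamma> e (f x))" "continuous_on S (\<lambda>x. cutoff_deriv \<gamma> e (f x))"
proof -
  have nz: "(f x)\<^sup>2 + e \<noteq> 0" for x using assms zero_le_power2[of "f x"] by linarith
  show "continuous_on S (\<lambda>x. cutoff \<gamma> e (f x))" "continuous_on S (\<lambda>x. cutoff_deriv \<gamma> e (f x))"
    unfolding cutoff_def cutoff_deriv_def using assms nz by (auto intro!: continuous_intros)
qed

lemma cutoff_nonpos: "t \<le> 0 \<Longrightarrow> cutoff \<gamma> e t = 0" "t \<le> 0 \<Longrightarrow> cutoff_deriv \<gamma> e t = 0"
  by (simp_all add: cutoff_def cutoff_deriv_def pos_powr_def)

text \<open>The factor by which \<open>cutoff\<close> differs from \<open>t powr \<gamma>\<close>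
  for t > 0. It lies in [0, 1] and tends to 1, so the factor \<gamma> + 2 - 2
  \<open>ratio e t\<close> in \<open>cutoff_pos\<close> is bounded by |\<gamma>| + 2 and tends to
  \<gamma>.\<close>

definition ratio :: "real \<Rightarrow> real \<Rightarrow> real" where
  "ratio e t = t\<^sup>2 / (t\<^sup>2 + e)"

lemma cutoff_pos:
  assumes "0 < t" "0 < e"
  shows "cutoff \<gamma> e t = t powr \<gamma> * ratio e t"
    "t * cutoff_deriv \<gamma> e t = t powr \<gamma> * (ratio e t * (\<gamma> + 2 - 2 * ratio e t))"
proof -
  have p: "t powr (\<gamma> + 2) = t powr \<gamma> * t\<^sup>2" "t powr (\<gamma> + 1) = t powr \<gamma> * t"
    using assms by (simp_all add: powr_add powr_numeral)
  show "cutoff \<gamma> e t = t powr \<gamma> * ratio e t"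
    using assms by (simp add: cutoff_def pos_powr_def p ratio_def)
  have "t * cutoff_deriv \<gamma> e t = (\<gamma> + 2) * (t powr \<gamma> * t * t) / (t\<^sup>2 + e)
      - 2 * (t powr \<gamma> * t\<^sup>2 * t * t) / (t\<^sup>2 + e)\<^sup>2"
    using assms by (simp add: cutoff_deriv_def pos_powr_def p right_diff_distrib mult_ac)
  also have "\<dots> = t powr \<gamma> * (ratio e t * (\<gamma> + 2 - 2 * ratio e t))"
    unfolding ratio_def by (simp add: right_diff_distrib power2_eq_square mult_ac)
  finally show "t * cutoff_deriv \<gamma> e t = t powr \<gamma> * (ratio e t * (\<gamma> + 2 - 2 * ratio e t))" .
qed

lemma ratio_bounds:
  assumes "0 < e"
  shows "0 \<le> ratio e t" "ratio e t \<le> 1"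
proof -
  have "0 < t\<^sup>2 + e" using assms by (simp add: add_nonneg_pos)
  then show "0 \<le> ratio e t" "ratio e t \<le> 1" using assms by (auto simp: ratio_def)
qed

lemma ratio_tendsto:
  assumes "t \<noteq> 0"
  shows "(\<lambda>n. ratio (inverse (real (Suc n))) t) \<longlonglongrightarrow> 1"
proof -
  have "(\<lambda>n. t\<^sup>2 / (t\<^sup>2 + inverse (real (Suc n)))) \<longlonglongrightarrow> t\<^sup>2 / (t\<^sup>2 + 0)"
    using assms by (intro tendsto_intros LIMSEQ_inverse_real_of_nat) auto
  then show ?thesis using assms by (simp add: ratio_def)
qed

lemma integral_partial_derivatives_zero:
  fixes F G f g :: "real \<times> real \<Rightarrow> complex"
  assumes F: "\<And>x y. ((\<lambda>x. F (x, y)) has_vector_derivative f (x, y)) (at x)"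
    and G: "\<And>x y. ((\<lambda>y. G (x, y)) has_vector_derivative g (x, y)) (at y)"
    and cont: "continuous_on UNIV f" "continuous_on UNIV g"
    and zero: "\<And>z. z \<notin> {- 1..1} \<times> {- 1..1} \<Longrightarrow> F z = 0 \<and> G z = 0 \<and> f z = 0 \<and> g z = 0"
  shows "(LINT z|lborel. f z + g z) = 0"
proof -
  have FTC: "(LINT s|lborel. u s) = 0"
    if U: "\<And>s. (U has_vector_derivative u s) (at s)" and u: "continuous_on UNIV u"
      and 0: "\<And>s. s \<notin> {- 1..1} \<Longrightarrow> u s = 0" "U (- 2) = 0" "U 2 = 0"
    for U u :: "real \<Rightarrow> complex"
  proof -
    \<comment> \<open>The endpoints -2 and 2 lie strictly outside the square that carries the
      functions, so both boundary values of U vanish.\<close>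
    have "has_bochner_integral lborel (\<lambda>s. indicator {- 2..2} s *\<^sub>R u s) (U 2 - U (- 2))"
    proof (rule has_bochner_integral_FTC_Icc)
      show "(U has_vector_derivative u s) (at s within {- 2..2})" for s
        using U by (rule has_vector_derivative_at_within)
      show "continuous_on {- 2..2} u" using u by (rule continuous_on_subset) auto
    qed simp
    moreover have "(\<lambda>s. indicator {- 2..2} s *\<^sub>R u s) = u"
      using 0(1) by (force simp: indicator_def fun_eq_iff)
    ultimately show ?thesis
      using 0 by (simp add: has_bochner_integral_integral_eq)
  qed
  have intg: "integrable lborel h"
    if "continuous_on UNIV h" "\<And>z. z \<notin> {- 1..1} \<times> {- 1..1} \<Longrightarrow> h z = 0"
    for h :: "real \<times> real \<Rightarrow> complex"
  proof -
    have "integrable lborel (\<lambda>z. indicator ({- 1..1} \<times> {- 1..1}) z *\<^sub>R h z)"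
      by (intro borel_integrable_compact compact_Times compact_Icc continuous_on_subset[OF that(1)]) auto
    moreover have "(\<lambda>z. indicator ({- 1..1} \<times> {- 1..1}) z *\<^sub>R h z) = h"
      using that(2) by (force simp: indicator_def fun_eq_iff)
    ultimately show ?thesis by simp
  qed
  have f: "integrable (lborel \<Otimes>\<^sub>M lborel) f" and g: "integrable (lborel \<Otimes>\<^sub>M lborel) g"
    unfolding lborel_prod using cont zero by (auto intro!: intg)
  have slices: "continuous_on UNIV (\<lambda>x. f (x, y))" "continuous_on UNIV (\<lambda>x. g (y, x))" for y
    by (intro continuous_on_compose2[OF cont(1)] continuous_on_compose2[OF cont(2)]
        continuous_intros subset_UNIV)+
  have "(LINT x|lborel. f (x, y)) = 0" for y
    by (rule FTC[OF F slices(1)]) (auto simp: zero)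
  then have "integral\<^sup>L lborel f = 0"
    using lborel_pair.integral_snd[of "\<lambda>x y. f (x, y)"] f by (simp add: lborel_prod)
  moreover have "(LINT y|lborel. g (x, y)) = 0" for x
    by (rule FTC[OF G slices(2)]) (auto simp: zero)
  then have "integral\<^sup>L lborel g = 0"
    using lborel_pair.integral_fst'[OF g] by (simp add: lborel_prod)
  ultimately show ?thesis
    using f g by (simp add: lborel_prod)
qed

lemma parab_has_partials:
  "((\<lambda>x. parab x y) has_real_derivative - (6 * x)) (at x)"
  "((\<lambda>y. parab x y) has_real_derivative 2) (at y)"
  unfolding parab_def by (auto intro!: derivative_eq_intros)

lemma cubic_has_partials:
  "((\<lambda>x. cubic x y) has_real_derivative 72 * x\<^sup>2 - 12 * y - 6) (at x)"
  "((\<lambda>y. cubic x y) has_real_derivative - (2 * y) - 12 * x - 4) (at y)"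
  unfolding cubic_def by (auto intro!: derivative_eq_intros)

lemma continuous_on_parab [continuous_intros]: "continuous_on S (\<lambda>z. parab (fst z) (snd z))"
  unfolding parab_def by (intro continuous_intros)

lemma continuous_on_cubic [continuous_intros]: "continuous_on S (\<lambda>z. cubic (fst z) (snd z))"
  unfolding cubic_def by (intro continuous_intros)

text \<open>By tangency the logarithmic derivatives of \<open>parab\<close> and \<open>cubic\<close>
  along the field are the polynomials Q1 and Q2. Hence the integrand is, on the region, the
  divergence of the weight times the field, and no exponent is lowered. Integration by parts is done
  for the regularised weights, and dominated convergence removes the regularisation.\<close>

lemma integral_weighted_divergence:
  fixes \<alpha> \<beta> :: real and V1 V2 Q1 Q2 :: bipoly
  assumes ab: "- 1 / 2 \<le> \<alpha>" "- 1 / 2 \<le> \<beta>"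
    and tangent_parab: "\<And>x y. of_real (- (6 * x)) * eval2 V1 x y + 2 * eval2 V2 x y =
      of_real (parab x y) * eval2 Q1 x y"
    and tangent_cubic: "\<And>x y. of_real (72 * x\<^sup>2 - 12 * y - 6) * eval2 V1 x y +
      of_real (- (2 * y) - 12 * x - 4) * eval2 V2 x y = of_real (cubic x y) * eval2 Q2 x y"
  shows "(LINT z|lborel. complex_of_real (power_weight \<alpha> \<beta> z) *
    eval2 (dx V1 + dy V2 + cst \<alpha> * Q1 + cst \<beta> * Q2) (fst z) (snd z)) = 0"
proof -
  define E where "E p z = eval2 p (fst z) (snd z)" for p and z :: "real \<times> real"
  define a b where "a e z = cutoff \<alpha> e (parab (fst z) (snd z))"
    and "b e z = cutoff \<beta> e (cubic (fst z) (snd z))" for e z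
  define a' b' where "a' e z = cutoff_deriv \<alpha> e (parab (fst z) (snd z))"
    and "b' e z = cutoff_deriv \<beta> e (cubic (fst z) (snd z))" for e z
  \<comment> \<open>\<open>f\<close> and \<open>g\<close> are the partial derivatives of the
    regularised weight times \<open>V1\<close> and times \<open>V2\<close>; for e > 0 their sum is
    \<open>power_weight\<close> times the bounded factor \<open>h\<close>.\<close>
  define f where "f e z = of_real (a e z * b e z) * E (dx V1) z +
    of_real ((a' e z * - (6 * fst z)) * b e z + a e z * (b' e z * (72 * (fst z)\<^sup>2 - 12 * snd z - 6))) * E V1 z" for e z
  define g where "g e z = of_real (a e z * b e z) * E (dy V2) z +
    of_real ((a' e z * 2) * b e z + a e z * (b' e z * (- (2 * snd z) - 12 * fst z - 4))) * E V2 z" for e z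
  define r s where "r e z = ratio e (parab (fst z) (snd z))"
    and "s e z = ratio e (cubic (fst z) (snd z))" for e z
  define h where "h e z = of_real (r e z * s e z) * E (dx V1 + dy V2) z +
     of_real (r e z * (\<alpha> + 2 - 2 * r e z) * s e z) * E Q1 z +
     of_real (r e z * (s e z * (\<beta> + 2 - 2 * s e z))) * E Q2 z" for e z
  have outside: "a e z * b e z = 0" "a' e z * b e z = 0" "a e z * b' e z = 0" if "z \<notin> region" for e z
    using that unfolding a_def b_def a'_def b'_def
    by (auto simp: region_def case_prod_beta not_less cutoff_nonpos)
  have fg: "f e z + g e z = of_real (power_weight \<alpha> \<beta> z) * h e z" if "0 < e" for e z
  proof -
    have "f e z + g e z = of_real (a e z * b e z) * E (dx V1 + dy V2) z
        + of_real (a' e z * b e z) * (of_real (- (6 * fst z)) * E V1 z + 2 * E V2 z)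
        + of_real (a e z * b' e z) * (of_real (72 * (fst z)\<^sup>2 - 12 * snd z - 6) * E V1 z
            + of_real (- (2 * snd z) - 12 * fst z - 4) * E V2 z)"
      unfolding f_def g_def E_def eval2_add by (simp add: algebra_simps)
    also have "\<dots> = of_real (a e z * b e z) * E (dx V1 + dy V2) z
        + of_real ((parab (fst z) (snd z) * a' e z) * b e z) * E Q1 z
        + of_real (a e z * (cubic (fst z) (snd z) * b' e z)) * E Q2 z"
      unfolding E_def tangent_parab tangent_cubic by (simp add: mult_ac)
    also have "\<dots> = of_real (power_weight \<alpha> \<beta> z) * h e z"
    proof (cases "z \<in> region")
      case True
      then have "0 < parab (fst z) (snd z)" "0 < cubic (fst z) (snd z)"
        by (auto simp: region_def case_prod_beta)
      note c = this[THEN cutoff_pos(1), OF that] this[THEN cutoff_pos(2), OF that]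
      show ?thesis
        unfolding a_def b_def a'_def b'_def c h_def r_def s_def
        using True by (simp add: power_weight_def algebra_simps)
    next
      case False
      with outside[OF False, of e] show ?thesis
        by (auto simp: power_weight_def)
    qed
    finally show ?thesis .
  qed
  have zero: "(LINT z|lborel. of_real (power_weight \<alpha> \<beta> z) * h e z) = 0" if e: "0 < e" for e
  proof -
    have "(LINT z|lborel. f e z + g e z) = 0"
    proof (rule integral_partial_derivatives_zero)
      fix x y
      have A: "((\<lambda>x. a e (x, y)) has_real_derivative a' e (x, y) * - (6 * x)) (at x)"
        unfolding a_def a'_def fst_conv snd_conv
        by (rule DERIV_chain2[OF cutoff_has_derivative parab_has_partials(1)]) (use ab e in auto)
      have B: "((\<lambda>x. b e (x, y)) has_real_derivative b' e (x, y) * (72 * x\<^sup>2 - 12 * y - 6)) (at x)"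
        unfolding b_def b'_def fst_conv snd_conv
        by (rule DERIV_chain2[OF cutoff_has_derivative cubic_has_partials(1)]) (use ab e in auto)
      have "((\<lambda>x. of_real (a e (x, y) * b e (x, y)) * E V1 (x, y)) has_vector_derivative
          of_real (a e (x, y) * b e (x, y)) * E (dx V1) (x, y) +
          of_real (a e (x, y) * (b' e (x, y) * (72 * x\<^sup>2 - 12 * y - 6)) +
            (a' e (x, y) * - (6 * x)) * b e (x, y)) * E V1 (x, y)) (at x)"
        unfolding E_def fst_conv snd_conv
        by (intro has_vector_derivative_mult has_vector_derivative_of_real DERIV_mult' A B eval2_has_dx)
      then show "((\<lambda>x. of_real (a e (x, y) * b e (x, y)) * E V1 (x, y)) has_vector_derivative
          f e (x, y)) (at x)"
        by (simp add: f_def add.commute)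
      have A: "((\<lambda>y. a e (x, y)) has_real_derivative a' e (x, y) * 2) (at y)"
        unfolding a_def a'_def fst_conv snd_conv
        by (rule DERIV_chain2[OF cutoff_has_derivative parab_has_partials(2)]) (use ab e in auto)
      have B: "((\<lambda>y. b e (x, y)) has_real_derivative b' e (x, y) * (- (2 * y) - 12 * x - 4)) (at y)"
        unfolding b_def b'_def fst_conv snd_conv
        by (rule DERIV_chain2[OF cutoff_has_derivative cubic_has_partials(2)]) (use ab e in auto)
      have "((\<lambda>y. of_real (a e (x, y) * b e (x, y)) * E V2 (x, y)) has_vector_derivative
          of_real (a e (x, y) * b e (x, y)) * E (dy V2) (x, y) +
          of_real (a e (x, y) * (b' e (x, y) * (- (2 * y) - 12 * x - 4)) +
            (a' e (x, y) * 2) * b e (x, y)) * E V2 (x, y)) (at y)"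
        unfolding E_def fst_conv snd_conv
        by (intro has_vector_derivative_mult has_vector_derivative_of_real DERIV_mult' A B eval2_has_dy)
      then show "((\<lambda>y. of_real (a e (x, y) * b e (x, y)) * E V2 (x, y)) has_vector_derivative
          g e (x, y)) (at y)"
        by (simp add: g_def add.commute)
    next
      show "continuous_on UNIV (f e)" "continuous_on UNIV (g e)"
        unfolding f_def g_def a_def b_def a'_def b'_def E_def
        by (intro continuous_intros continuous_on_eval2 ab e)+
    next
      fix z :: "real \<times> real" assume "z \<notin> {- 1..1} \<times> {- 1..1}"
      then have "z \<notin> region" using region_bounded by blast
      from outside[OF this, of e]
      show "of_real (a e z * b e z) * E V1 z = 0 \<and> of_real (a e z * b e z) * E V2 z = 0 \<and>
          f e z = 0 \<and> g e z = 0"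
        unfolding f_def g_def by auto
    qed
    then show ?thesis using fg[OF e] by simp
  qed
  let ?e = "\<lambda>n. inverse (real (Suc n))"
  let ?lim = "\<lambda>z. E (dx V1 + dy V2) z + of_real \<alpha> * E Q1 z + of_real \<beta> * E Q2 z"
  obtain M0 where M0: "0 \<le> M0" "\<And>z. z \<in> region \<Longrightarrow> norm (E (dx V1 + dy V2) z) \<le> M0"
    using eval2_bounded_on_region[of "dx V1 + dy V2"] unfolding E_def by blast
  obtain M1 where M1: "0 \<le> M1" "\<And>z. z \<in> region \<Longrightarrow> norm (E Q1 z) \<le> M1"
    using eval2_bounded_on_region[of Q1] unfolding E_def by blast
  obtain M2 where M2: "0 \<le> M2" "\<And>z. z \<in> region \<Longrightarrow> norm (E Q2 z) \<le> M2"
    using eval2_bounded_on_region[of Q2] unfolding E_def by blast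
  define M where "M = M0 + (\<bar>\<alpha>\<bar> + 2) * M1 + (\<bar>\<beta>\<bar> + 2) * M2"
  have bound: "norm (h e z) \<le> M" if e: "0 < e" and z: "z \<in> region" for e z
  proof -
    have rs: "0 \<le> r e z" "r e z \<le> 1" "0 \<le> s e z" "s e z \<le> 1"
      unfolding r_def s_def using ratio_bounds[OF e] by auto
    have "norm (of_real (r e z * s e z) * E (dx V1 + dy V2) z) \<le> (1 * 1) * M0"
      unfolding norm_mult norm_of_real abs_mult using rs M0(1) M0(2)[OF z]
      by (intro mult_mono) auto
    moreover have "norm (of_real (r e z * (\<alpha> + 2 - 2 * r e z) * s e z) * E Q1 z) \<le> (1 * (\<bar>\<alpha>\<bar> + 2) * 1) * M1"
      unfolding norm_mult norm_of_real abs_mult using rs M1(1) M1(2)[OF z]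
      by (intro mult_mono) auto
    moreover have "norm (of_real (r e z * (s e z * (\<beta> + 2 - 2 * s e z))) * E Q2 z) \<le> (1 * (1 * (\<bar>\<beta>\<bar> + 2))) * M2"
      unfolding norm_mult norm_of_real abs_mult using rs M2(1) M2(2)[OF z]
      by (intro mult_mono) auto
    ultimately have "norm (h e z) \<le> (1 * 1) * M0 + (1 * (\<bar>\<alpha>\<bar> + 2) * 1) * M1 + (1 * (1 * (\<bar>\<beta>\<bar> + 2))) * M2"
      unfolding h_def by (intro norm_triangle_mono)
    then show ?thesis by (simp add: M_def)
  qed
  have lim: "(\<lambda>n. h (?e n) z) \<longlonglongrightarrow> ?lim z" if z: "z \<in> region" for z
  proof -
    have "parab (fst z) (snd z) \<noteq> 0" "cubic (fst z) (snd z) \<noteq> 0"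
      using z by (auto simp: region_def case_prod_beta)
    then have r: "(\<lambda>n. r (?e n) z) \<longlonglongrightarrow> 1" and s: "(\<lambda>n. s (?e n) z) \<longlonglongrightarrow> 1"
      unfolding r_def s_def by (auto intro: ratio_tendsto simp del: of_nat_Suc)
    have "(\<lambda>n. h (?e n) z) \<longlonglongrightarrow> of_real (1 * 1) * E (dx V1 + dy V2) z +
        of_real (1 * (\<alpha> + 2 - 2 * 1) * 1) * E Q1 z + of_real (1 * (1 * (\<beta> + 2 - 2 * 1))) * E Q2 z"
      unfolding h_def by (intro tendsto_add tendsto_diff tendsto_mult tendsto_of_real tendsto_const r s)
    then show ?thesis by simp
  qed
  have [measurable]: "(\<lambda>z. E p z) \<in> borel_measurable borel" for p
    unfolding E_def by measurable
  have [measurable]: "r e \<in> borel_measurable borel" "s e \<in> borel_measurable borel" for e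
    unfolding r_def[abs_def] s_def[abs_def] ratio_def by measurable
  have [measurable]: "h e \<in> borel_measurable borel" for e
    unfolding h_def[abs_def] by measurable
  have "(\<lambda>n. LINT z|lborel. of_real (power_weight \<alpha> \<beta> z) * h (?e n) z) \<longlonglongrightarrow>
      (LINT z|lborel. of_real (power_weight \<alpha> \<beta> z) * ?lim z)"
  proof (rule integral_dominated_convergence)
    show "integrable lborel (\<lambda>z. power_weight \<alpha> \<beta> z * M)"
      using integrable_power_weight[OF ab] by simp
    show "AE z in lborel. norm (of_real (power_weight \<alpha> \<beta> z) * h (?e n) z) \<le> power_weight \<alpha> \<beta> z * M" for n
    proof (rule AE_I2)
      fix z
      show "norm (of_real (power_weight \<alpha> \<beta> z) * h (?e n) z) \<le> power_weight \<alpha> \<beta> z * M"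
      proof (cases "z \<in> region")
        case True
        then have "norm (h (?e n) z) \<le> M" by (intro bound) auto
        then show ?thesis
          by (simp add: norm_mult power_weight_nonneg mult_left_mono)
      qed (simp add: power_weight_def)
    qed
    show "AE z in lborel. (\<lambda>n. of_real (power_weight \<alpha> \<beta> z) * h (?e n) z) \<longlonglongrightarrow>
        of_real (power_weight \<alpha> \<beta> z) * ?lim z"
    proof (rule AE_I2)
      fix z
      show "(\<lambda>n. of_real (power_weight \<alpha> \<beta> z) * h (?e n) z) \<longlonglongrightarrow>
        of_real (power_weight \<alpha> \<beta> z) * ?lim z"
      proof (cases "z \<in> region")
        case True
        then show ?thesis by (intro tendsto_mult tendsto_const lim)
      qed (simp add: power_weight_def)
    qed
  qed measurable
  then have "(LINT z|lborel. of_real (power_weight \<alpha> \<beta> z) * ?lim z) = 0"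
    using zero by (simp add: LIMSEQ_const_iff)
  then show ?thesis by (simp add: E_def)
qed

section \<open>The inner product\<close>

definition weight_const :: "real \<Rightarrow> real \<Rightarrow> real" where
  "weight_const \<alpha> \<beta> = (4 * pi\<^sup>2) powr (\<alpha> + \<beta>) / 3 powr (2 * \<alpha> + \<beta>)"

lemma weight_const_pos: "0 < weight_const \<alpha> \<beta>"
  by (simp add: weight_const_def)

text \<open>This holds at every point, without an appeal to null sets: a point of
  \<open>triangle_star\<close> outside \<open>region\<close> is a zero of one of the two
  polynomials, and \<open>powr\<close> has the value 0 at base 0.\<close>

lemma indicator_weight:
  "indicator triangle_star z * weight \<alpha> \<beta> z = weight_const \<alpha> \<beta> * power_weight \<alpha> \<beta> z"
proof -
  obtain x y where z: "z = (x, y)" by force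
  have w: "weight \<alpha> \<beta> z = weight_const \<alpha> \<beta> * (parab x y powr \<alpha> * cubic x y powr \<beta>)"
    by (simp add: weight_def z weight_const_def parab_def cubic_def)
  show ?thesis
  proof (cases "z \<in> triangle_star \<and> z \<notin> region")
    case True
    then have "parab x y = 0 \<or> cubic x y = 0"
      using triangle_star_nonneg[of x y] by (auto simp: z region_def)
    with True show ?thesis by (auto simp: w power_weight_def)
  next
    case False
    then have "indicator triangle_star z = (indicator region z :: real)"
      using region_subset_triangle_star by (auto simp: indicator_def)
    then show ?thesis by (simp add: w power_weight_def) (simp add: z)
  qed
qed

lemma set_integral_weight:
  "set_lebesgue_integral lborel triangle_star (weight \<alpha> \<beta>) =
     weight_const \<alpha> \<beta> * (LINT z|lborel. power_weight \<alpha> \<beta> z)"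
  unfolding set_lebesgue_integral_def by (simp add: indicator_weight)

lemma inner_w_eq:
  "inner_w \<alpha> \<beta> f g = of_real (norm_const \<alpha> \<beta> * weight_const \<alpha> \<beta>) *
     (LINT z|lborel. of_real (power_weight \<alpha> \<beta> z) *
       (eval2 f (fst z) (snd z) * cnj (eval2 g (fst z) (snd z))))"
proof -
  have "indicator triangle_star z *\<^sub>R
      (case z of (x, y) \<Rightarrow> eval2 f x y * cnj (eval2 g x y) * complex_of_real (weight \<alpha> \<beta> (x, y))) =
      of_real (weight_const \<alpha> \<beta>) * (of_real (power_weight \<alpha> \<beta> z) *
       (eval2 f (fst z) (snd z) * cnj (eval2 g (fst z) (snd z))))" for z
  proof -
    have "complex_of_real (indicator triangle_star z) * complex_of_real (weight \<alpha> \<beta> z) =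
        of_real (weight_const \<alpha> \<beta>) * of_real (power_weight \<alpha> \<beta> z)"
      unfolding of_real_mult[symmetric] indicator_weight ..
    then show ?thesis
      by (simp add: case_prod_beta scaleR_conv_of_real mult_ac)
  qed
  then show ?thesis
    by (simp add: inner_w_def set_lebesgue_integral_def mult_ac)
qed

section \<open>Definiteness of the inner product\<close>

lemma eval2_eq_0_imp:
  assumes "infinite A" "infinite B" "\<And>x y. x \<in> A \<Longrightarrow> y \<in> B \<Longrightarrow> eval2 p x y = 0"
  shows "p = 0"
proof (rule ccontr)
  assume p: "p \<noteq> 0"
  have "poly p [:complex_of_real y:] = 0" if "y \<in> B" for y
  proof (rule ccontr)
    assume "poly p [:complex_of_real y:] \<noteq> 0"
    then have "finite {z. poly (poly p [:complex_of_real y:]) z = 0}"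
      by (rule poly_roots_finite)
    moreover have "complex_of_real ` A \<subseteq> {z. poly (poly p [:complex_of_real y:]) z = 0}"
      using assms(3) that by (auto simp: eval2_def)
    ultimately have "finite (complex_of_real ` A)" by (rule finite_subset[rotated])
    then show False using assms(1) by (simp add: finite_image_iff inj_on_def)
  qed
  \<comment> \<open>As a polynomial in y over the integral domain of polynomials in x, p has
    infinitely many constant roots.\<close>
  then have "(\<lambda>y. [:complex_of_real y:]) ` B \<subseteq> {q. poly p q = 0}" by auto
  then have "finite ((\<lambda>y. [:complex_of_real y:]) ` B)"
    using poly_roots_finite[OF p] by (rule finite_subset)
  then show False using assms(2) by (simp add: finite_image_iff inj_on_def)
qed

lemma bipoly_eqI:
  assumes "\<And>x y. eval2 p x y = eval2 q x y"
  shows "p = q"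
  using eval2_eq_0_imp[of UNIV UNIV "p - q"] assms by (simp add: infinite_UNIV_char_0)

lemma region_nonempty: "(0, - 2 / 5) \<in> region"
  by (simp add: region_def parab_def cubic_def power2_eq_square)

lemma eval2_eq_0_on_region:
  assumes "\<And>z. z \<in> region \<Longrightarrow> eval2 p (fst z) (snd z) = 0"
  shows "p = 0"
proof -
  obtain A B where AB: "open A" "open B" "(0, - 2 / 5) \<in> A \<times> B" "A \<times> B \<subseteq> region"
    using open_prod_elim[OF open_region region_nonempty] by blast
  have "A \<noteq> {}" "B \<noteq> {}" using AB(3) by auto
  then have "infinite A" "infinite B"
    using AB(1,2) open_not_negligible negligible_finite by blast+
  then show ?thesis
    using assms AB by (intro eval2_eq_0_imp[of A B]) auto
qed

text \<open>The weight is positive on \<open>region\<close>, so the points of it where p does not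
  vanish form an open null set, which is empty. The case p = 1 shows that the total mass is
  positive.\<close>

lemma integral_power_weight_norm_eq_0:
  assumes ab: "- 1 / 2 \<le> \<alpha>" "- 1 / 2 \<le> \<beta>"
    and 0: "(LINT z|lborel. power_weight \<alpha> \<beta> z * (cmod (eval2 p (fst z) (snd z)))\<^sup>2) = 0"
  shows "p = 0"
proof -
  let ?g = "\<lambda>z. power_weight \<alpha> \<beta> z * (cmod (eval2 p (fst z) (snd z)))\<^sup>2"
  obtain M where M: "0 \<le> M" "\<And>z. z \<in> region \<Longrightarrow> norm (eval2 p (fst z) (snd z)) \<le> M"
    using eval2_bounded_on_region[of p] by blast
  have "integrable lborel ?g"
  proof (rule Bochner_Integration.integrable_bound)
    show "integrable lborel (\<lambda>z. power_weight \<alpha> \<beta> z * M\<^sup>2)"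
      using integrable_power_weight[OF ab] by simp
    have "?g z \<le> power_weight \<alpha> \<beta> z * M\<^sup>2" for z
    proof (cases "z \<in> region")
      case True
      then show ?thesis
        using M by (intro mult_left_mono power_mono power_weight_nonneg) auto
    qed (simp add: power_weight_def)
    then show "AE z in lborel. norm (?g z) \<le> norm (power_weight \<alpha> \<beta> z * M\<^sup>2)"
      by (simp add: power_weight_nonneg abs_mult)
  qed simp
  then have AE: "AE z in lborel. ?g z = 0"
    using 0 by (subst (asm) integral_nonneg_eq_0_iff_AE) (auto simp: power_weight_nonneg)
  define N where "N = {z \<in> region. eval2 p (fst z) (snd z) \<noteq> 0}"
  have "open N"
    unfolding N_def Collect_conj_eq Collect_mem_eq
    by (intro open_Int open_region open_Collect_neq continuous_on_eval2 continuous_intros)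
  moreover have "?g z \<noteq> 0" if "z \<in> N" for z
    using that by (auto simp: N_def power_weight_def region_def)
  then have "AE z in lborel. z \<notin> N"
    using AE by (auto elim!: eventually_mono)
  then have "N \<in> null_sets lborel"
    using \<open>open N\<close> by (subst AE_iff_null_sets) auto
  then have "negligible N"
    unfolding negligible_iff_null_sets by (rule null_sets_completionI)
  ultimately have "N = {}"
    using open_not_negligible by blast
  then show ?thesis by (intro eval2_eq_0_on_region) (auto simp: N_def)
qed

lemma integral_power_weight_pos:
  assumes "- 1 / 2 \<le> \<alpha>" "- 1 / 2 \<le> \<beta>"
  shows "0 < (LINT z|lborel. power_weight \<alpha> \<beta> z)"
proof -
  have "(LINT z|lborel. power_weight \<alpha> \<beta> z) \<noteq> 0"
    using integral_power_weight_norm_eq_0[OF assms, of 1] by auto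
  moreover have "0 \<le> (LINT z|lborel. power_weight \<alpha> \<beta> z)"
    by (simp add: power_weight_nonneg)
  ultimately show ?thesis by simp
qed

text \<open>A total mass of 0 would make the normalisation 1 / 0 = 0 and every two polynomials
  orthogonal.\<close>

lemma norm_const_pos:
  assumes "- 1 / 2 \<le> \<alpha>" "- 1 / 2 \<le> \<beta>"
  shows "0 < norm_const \<alpha> \<beta>"
  using integral_power_weight_pos[OF assms] weight_const_pos
  by (simp add: norm_const_def set_integral_weight)

text \<open>Conjugates the coefficients, hence the values at real points, so that inner products
  become integrals of polynomials. It commutes with the operator, whose coefficients are
  real.\<close>

definition cnj_bipoly :: "bipoly \<Rightarrow> bipoly" where
  "cnj_bipoly p = map_poly (map_poly cnj) p"

lemma eval2_cnj_bipoly [simp]: "eval2 (cnj_bipoly p) x y = cnj (eval2 p x y)"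
proof (induction p)
  case (pCons a p)
  have "cnj_bipoly (pCons a p) = pCons (map_poly cnj a) (cnj_bipoly p)"
    using pCons by (auto simp: cnj_bipoly_def map_poly_pCons)
  moreover have "poly (map_poly cnj a) (complex_of_real x) = cnj (poly a (complex_of_real x))"
    using poly_cnj[of a "complex_of_real x"] by simp
  ultimately show ?case
    using pCons by (simp add: eval2_pCons)
qed (simp add: cnj_bipoly_def)

lemma dx_cnj_bipoly: "dx (cnj_bipoly p) = cnj_bipoly (dx p)"
  by (intro poly_eqI) (simp add: dx_def cnj_bipoly_def coeff_map_poly coeff_pderiv)

lemma dy_cnj_bipoly: "dy (cnj_bipoly p) = cnj_bipoly (dy p)"
  by (intro poly_eqI) (simp add: dy_def cnj_bipoly_def coeff_map_poly coeff_pderiv of_nat_poly del: of_nat_Suc)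

lemma L_op_cnj_bipoly: "L_op \<alpha> \<beta> (cnj_bipoly p) = cnj_bipoly (L_op \<alpha> \<beta> p)"
  by (intro bipoly_eqI)
    (simp add: L_op_def dx_cnj_bipoly dy_cnj_bipoly A11_def A12_def A22_def B1_def B2_def)

section \<open>Orthogonal eigenpolynomials\<close>

locale jacobi_weight =
  fixes \<alpha> \<beta> :: real
  assumes exponents: "- 1 / 2 \<le> \<alpha>" "- 1 / 2 \<le> \<beta>"
begin

definition weighted_integral :: "bipoly \<Rightarrow> complex" where
  "weighted_integral p = (LINT z|lborel. of_real (power_weight \<alpha> \<beta> z) * eval2 p (fst z) (snd z))"

lemma weighted_integral_add:
  "weighted_integral (p + q) = weighted_integral p + weighted_integral q"
  unfolding weighted_integral_def eval2_add distrib_left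
  by (intro Bochner_Integration.integral_add integrable_power_weight_eval2 exponents)

lemma weighted_integral_scale: "weighted_integral (scale c p) = c * weighted_integral p"
  unfolding weighted_integral_def eval2_scale
  by (simp add: mult.left_commute[of _ c])

lemma weighted_integral_minus: "weighted_integral (- p) = - weighted_integral p"
  unfolding weighted_integral_def by simp

lemma weighted_integral_diff:
  "weighted_integral (p - q) = weighted_integral p - weighted_integral q"
  using weighted_integral_add[of p "- q"] by (simp add: weighted_integral_minus)

abbreviation ip :: "bipoly \<Rightarrow> bipoly \<Rightarrow> complex" where
  "ip \<equiv> inner_w \<alpha> \<beta>"

lemma ip_eq: "ip f g = of_real (norm_const \<alpha> \<beta> * weight_const \<alpha> \<beta>) * weighted_integral (f * cnj_bipoly g)"
  by (simp add: inner_w_eq weighted_integral_def)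

lemma ip_add_left: "ip (f + g) h = ip f h + ip g h"
  by (simp add: ip_eq weighted_integral_add distrib_right distrib_left)

lemma ip_diff_left: "ip (f - g) h = ip f h - ip g h"
  by (simp add: ip_eq weighted_integral_diff left_diff_distrib right_diff_distrib)

lemma ip_scale_left: "ip (scale c f) h = c * ip f h"
  by (simp add: ip_eq scale_mult_left weighted_integral_scale)

lemma ip_cnj: "ip g f = cnj (ip f g)"
proof -
  have "cnj (weighted_integral (f * cnj_bipoly g)) =
      (LINT z|lborel. cnj (of_real (power_weight \<alpha> \<beta> z) * eval2 (f * cnj_bipoly g) (fst z) (snd z)))"
    unfolding weighted_integral_def by (rule Bochner_Integration.integral_cnj[symmetric])
  also have "\<dots> = weighted_integral (g * cnj_bipoly f)"
    unfolding weighted_integral_def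
    by (intro Bochner_Integration.integral_cong refl) (simp add: mult.commute)
  finally have "weighted_integral (g * cnj_bipoly f) = cnj (weighted_integral (f * cnj_bipoly g))" ..
  then show ?thesis by (simp add: ip_eq)
qed

lemma ip_add_right: "ip h (f + g) = ip h f + ip h g"
  using ip_add_left[of f g h] by (simp add: ip_cnj[of h])

lemma ip_diff_right: "ip h (f - g) = ip h f - ip h g"
  using ip_diff_left[of f g h] by (simp add: ip_cnj[of h])

lemma ip_scale_right: "ip h (scale c f) = cnj c * ip h f"
  using ip_scale_left[of c f h] by (simp add: ip_cnj[of h])

lemma ip_zero_right [simp]: "ip h 0 = 0"
  using ip_scale_right[of h 0 0] by simp

lemma ip_self_eq_0:
  assumes "ip f f = 0"
  shows "f = 0"
proof -
  have "weighted_integral (f * cnj_bipoly f) =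
      (LINT z|lborel. of_real (power_weight \<alpha> \<beta> z * (cmod (eval2 f (fst z) (snd z)))\<^sup>2))"
    unfolding weighted_integral_def by (simp add: complex_norm_square[symmetric])
  also have "\<dots> = of_real (LINT z|lborel. power_weight \<alpha> \<beta> z * (cmod (eval2 f (fst z) (snd z)))\<^sup>2)"
    by (rule integral_complex_of_real)
  finally have "(LINT z|lborel. power_weight \<alpha> \<beta> z * (cmod (eval2 f (fst z) (snd z)))\<^sup>2) = 0"
    using assms norm_const_pos[OF exponents] weight_const_pos[of \<alpha> \<beta>] by (simp add: ip_eq)
  then show ?thesis by (rule integral_power_weight_norm_eq_0[OF exponents])
qed

text \<open>Lagrange's identity for f and the conjugate of g leaves a weighted divergence. Tangency
  is a matter of polynomial identities: the matrix of \<open>A11\<close>, \<open>A12\<close>,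
  \<open>A22\<close> maps the gradients of \<open>parab\<close> and \<open>cubic\<close> to
  multiples of \<open>parab\<close> and \<open>cubic\<close>.\<close>

lemma ip_L_op: "ip (L_op \<alpha> \<beta> f) g = ip f (L_op \<alpha> \<beta> g)"
proof -
  define h where "h = cnj_bipoly g"
  define D1 D2 where "D1 = dx f * h - f * dx h" and "D2 = dy f * h - f * dy h"
  have "weighted_integral (dx (A11 * D1 + A12 * D2) + dy (A12 * D1 + A22 * D2)
       + cst \<alpha> * (- (12 * polyX + 6) * D1 - (36 * polyX + 18 * polyY) * D2)
       + cst \<beta> * (- (18 * polyX) * D1 - (18 + 36 * polyY) * D2)) = 0"
    unfolding weighted_integral_def
    by (rule integral_weighted_divergence[OF exponents])
      (simp_all add: A11_def A12_def A22_def parab_def cubic_def algebra_simps power2_eq_square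
        power3_eq_cube)
  then have "weighted_integral (L_op \<alpha> \<beta> f * h - f * L_op \<alpha> \<beta> h) = 0"
    unfolding L_op_lagrange D1_def D2_def weighted_integral_minus by simp
  then show ?thesis
    by (simp add: ip_eq weighted_integral_diff h_def L_op_cnj_bipoly)
qed

lemma ip_span_eq_0:
  assumes "\<And>b. b \<in> B \<Longrightarrow> ip p b = 0" "q \<in> bipoly.span B"
  shows "ip p q = 0"
  using assms(2)
  by (induction rule: bipoly.span_induct_alt) (simp_all add: assms(1) ip_add_right ip_scale_right)

text \<open>Gram-Schmidt, one vector at a time: \<open>b - t\<close> is the part of b orthogonal to
  B, and the residue \<open>v - s\<close> is corrected along it. The induction hypothesis is applied
  to b as well as to v, hence the generalisation over v.\<close>

lemma orthogonal_projection:
  assumes "finite B"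
  shows "\<exists>s\<in>bipoly.span B. \<forall>b\<in>B. ip (v - s) b = 0"
  using assms
proof (induction B arbitrary: v rule: finite_induct)
  case empty
  show ?case by (simp add: bipoly.span_zero)
next
  case (insert b B)
  have sub: "bipoly.span B \<subseteq> bipoly.span (insert b B)" by (rule bipoly.span_mono) auto
  obtain t where t: "t \<in> bipoly.span B" "\<forall>c\<in>B. ip (b - t) c = 0" using insert.IH[of b] by blast
  obtain s where s: "s \<in> bipoly.span B" "\<forall>c\<in>B. ip (v - s) c = 0" using insert.IH[of v] by blast
  define c where "c = ip (v - s) (b - t) / ip (b - t) (b - t)"
  define r where "r = s + scale c (b - t)"
  have "b - t \<in> bipoly.span (insert b B)"
    using subsetD[OF sub t(1)] by (rule bipoly.span_diff[OF bipoly.span_base, rotated]) simp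
  then have "r \<in> bipoly.span (insert b B)"
    unfolding r_def using s(1) sub by (intro bipoly.span_add bipoly.span_scale) auto
  moreover have B: "ip (v - r) a = 0" if "a \<in> B" for a
  proof -
    have "v - r = (v - s) - scale c (b - t)" by (simp add: r_def)
    then show ?thesis using that s(2) t(2) by (simp only: ip_diff_left ip_scale_left) simp
  qed
  moreover have "ip (v - r) b = 0"
  proof -
    have "ip (v - r) (b - t) = ip (v - s) (b - t) - c * ip (b - t) (b - t)"
    proof -
      have "v - r = (v - s) - scale c (b - t)" by (simp add: r_def)
      then show ?thesis by (simp only: ip_diff_left ip_scale_left)
    qed
    also have "\<dots> = 0"
    proof (cases "ip (b - t) (b - t) = 0")
      \<comment> \<open>If b already lies in the span of B, then \<open>b - t = 0\<close> and the
        default value 0 of the quotient \<open>c\<close> is harmless.\<close>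
      case True
      then have "b - t = 0" by (rule ip_self_eq_0)
      then show ?thesis by simp
    qed (simp add: c_def)
    finally have "ip (v - r) b = ip (v - r) t" by (simp add: ip_diff_right)
    also have "\<dots> = 0" using B t(1) by (rule ip_span_eq_0)
    finally show ?thesis .
  qed
  ultimately show ?case by blast
qed

definition monic_orthogonal :: "nat \<times> nat \<Rightarrow> bipoly \<Rightarrow> bool" where
  "monic_orthogonal k p \<longleftrightarrow> p - mon k \<in> below k \<and> (\<forall>q\<in>below k. ip p q = 0)"

lemma monic_orthogonal_exists: "\<exists>p. monic_orthogonal k p"
proof -
  obtain s where s: "s \<in> below k" "\<forall>b\<in>mon ` {j. j \<prec>\<^sub>* k}. ip (mon k - s) b = 0"
    using orthogonal_projection[of "mon ` {j. j \<prec>\<^sub>* k}" "mon k"] finite_star_less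
    unfolding below_def by blast
  have "ip (mon k - s) q = 0" if "q \<in> below k" for q
    using ip_span_eq_0[of "mon ` {j. j \<prec>\<^sub>* k}" "mon k - s" q] s(2) that by (auto simp: below_def)
  moreover have "(mon k - s) - mon k \<in> below k"
    using s(1) unfolding below_def by (simp add: bipoly.span_neg)
  ultimately show ?thesis unfolding monic_orthogonal_def by blast
qed

lemma monic_orthogonal_unique:
  assumes "monic_orthogonal k p" "monic_orthogonal k q"
  shows "p = q"
proof -
  have "p - q \<in> below k"
    using below_diff[of "p - mon k" k "q - mon k"] assms by (simp add: monic_orthogonal_def)
  then have "ip (p - q) (p - q) = 0"
    using assms by (simp add: ip_diff_left monic_orthogonal_def)
  then show ?thesis using ip_self_eq_0 by fastforce
qed

text \<open>The defect r is orthogonal to itself: symmetry moves the operator from p to r, and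
  \<open>below k\<close>, which contains r, is invariant under the operator.\<close>

lemma monic_orthogonal_eigenfunction:
  assumes "monic_orthogonal k p"
  shows "L_op \<alpha> \<beta> p = scale (of_real (eigenval \<alpha> \<beta> k)) p"
proof -
  let ?c = "complex_of_real (eigenval \<alpha> \<beta> k)"
  define s where "s = p - mon k"
  define r where "r = L_op \<alpha> \<beta> p - scale ?c p"
  have s: "s \<in> below k" and orth: "\<And>q. q \<in> below k \<Longrightarrow> ip p q = 0"
    using assms by (auto simp: monic_orthogonal_def s_def)
  have p: "p = mon k + s" by (simp add: s_def)
  have "r = (L_op \<alpha> \<beta> (mon k) - scale ?c (mon k)) + (L_op \<alpha> \<beta> s - scale ?c s)"
    unfolding r_def p by (simp add: L_op_add bipoly.scale_right_distrib)
  then have r: "r \<in> below k"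
    using s by (auto intro: below_add[OF L_op_mon] below_diff below_scale L_op_below)
  have "ip r r = ip p (L_op \<alpha> \<beta> r) - ?c * ip p r"
    by (simp add: r_def[symmetric] ip_L_op[symmetric]) (simp add: r_def ip_diff_left ip_scale_left)
  also have "\<dots> = 0" using r by (simp add: orth L_op_below)
  finally have "r = 0" by (rule ip_self_eq_0)
  then show ?thesis by (simp add: r_def)
qed

lemma monic_orthogonal_ip:
  assumes "monic_orthogonal k p" "monic_orthogonal j q" "k \<noteq> j"
  shows "ip p q = 0"
proof -
  have *: "ip p q = 0" if "monic_orthogonal k p" "monic_orthogonal j q" "j \<prec>\<^sub>* k" for k j p q
  proof -
    have "q - mon j \<in> below k"
      using that(2) below_mono[OF that(3)] by (auto simp: monic_orthogonal_def)
    then have "q \<in> below k"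
      using below_add[OF _ mon_in_below[OF that(3)], of "q - mon j"] by simp
    then show ?thesis using that by (auto simp: monic_orthogonal_def)
  qed
  show ?thesis
    using star_less_linear[of k j] *[OF assms(1,2)] *[OF assms(2,1)] assms(3) ip_cnj[of p q] by auto
qed

text \<open>Reduces uniqueness of the family to uniqueness for each k. Orthogonality to earlier
  members passes to earlier monomials by well-founded induction, as \<open>mon j\<close> differs
  from \<open>P j\<close> only by monomials before j.\<close>

lemma monic_orthogonal_if_family:
  assumes monic: "\<And>k. P k - mon k \<in> below k" and orth: "\<And>k j. k \<noteq> j \<Longrightarrow> ip (P k) (P j) = 0"
  shows "monic_orthogonal k (P k)"
proof -
  have mon: "j \<prec>\<^sub>* k \<longrightarrow> ip (P k) (mon j) = 0" for j
  proof (induction j rule: wfp_induct_rule[OF wf_star_less])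
    case (1 j)
    show ?case
    proof
      assume j: "j \<prec>\<^sub>* k"
      have "ip (P k) (P j - mon j) = 0"
      proof (rule ip_span_eq_0)
        show "P j - mon j \<in> bipoly.span (mon ` {i. i \<prec>\<^sub>* j})"
          using monic[of j] unfolding below_def .
        show "ip (P k) b = 0" if "b \<in> mon ` {i. i \<prec>\<^sub>* j}" for b
          using that 1 star_less_trans[OF _ j] by blast
      qed
      moreover have "ip (P k) (P j) = 0" using j star_less_irrefl[of k] by (intro orth) blast
      ultimately show "ip (P k) (mon j) = 0" by (simp add: ip_diff_right)
    qed
  qed
  have "ip (P k) q = 0" if "q \<in> below k" for q
    by (rule ip_span_eq_0[OF _ that[unfolded below_def]]) (use mon in blast)
  then show ?thesis using monic by (simp add: monic_orthogonal_def)
qed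

end

section \<open>Leading terms in the star-order\<close>

lemma leading_term_mon_iff: "leading_term p (mon k) \<longleftrightarrow> p - mon k \<in> below k"
proof
  assume "leading_term p (mon k)"
  then obtain m c where p: "p = (\<Sum>j | j \<preceq>\<^sub>* m. scale (c j) (mon j))" and
    lead: "mon k = scale (c m) (mon m)"
    unfolding leading_term_def by blast
  \<comment> \<open>The sum may a priori run up to some other exponent m; the coefficient at k
    forces m = k and \<open>c k = 1\<close>.\<close>
  have "coeff (coeff (mon k) (snd k)) (fst k) = coeff (coeff (scale (c m) (mon m)) (snd k)) (fst k)"
    using lead by simp
  then have m: "m = k" and c: "c k = 1"
    by (cases k; cases m; auto simp: coeff_mon scale_def split: if_splits)+
  have "{j. j \<preceq>\<^sub>* k} = insert k {j. j \<prec>\<^sub>* k}" by (auto simp: star_le_def)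
  then have "p - mon k = (\<Sum>j | j \<prec>\<^sub>* k. scale (c j) (mon j))"
    using c finite_star_less star_less_irrefl by (simp add: p m)
  also have "\<dots> \<in> below k"
    unfolding below_def by (intro bipoly.span_sum bipoly.span_scale bipoly.span_base) auto
  finally show "p - mon k \<in> below k" .
next
  assume "p - mon k \<in> below k"
  then obtain u where "p - mon k = (\<Sum>v\<in>mon ` {j. j \<prec>\<^sub>* k}. scale (u v) v)"
    unfolding below_def bipoly.span_finite[OF finite_imageI[OF finite_star_less]] by blast
  also have "\<dots> = (\<Sum>j | j \<prec>\<^sub>* k. scale (u (mon j)) (mon j))"
    using inj_mon by (subst sum.reindex) (auto intro: inj_on_subset)
  finally have u: "p - mon k = (\<Sum>j | j \<prec>\<^sub>* k. scale (u (mon j)) (mon j))" .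
  define c where "c j = (if j = k then 1 else u (mon j))" for j
  have "{j. j \<preceq>\<^sub>* k} = insert k {j. j \<prec>\<^sub>* k}" by (auto simp: star_le_def)
  moreover have "(\<Sum>j | j \<prec>\<^sub>* k. scale (c j) (mon j)) = (\<Sum>j | j \<prec>\<^sub>* k. scale (u (mon j)) (mon j))"
    using star_less_irrefl by (intro sum.cong) (auto simp: c_def)
  ultimately have "(\<Sum>j | j \<preceq>\<^sub>* k. scale (c j) (mon j)) = scale (c k) (mon k) + (p - mon k)"
    using finite_star_less star_less_irrefl by (simp add: u)
  then have "p = (\<Sum>j | j \<preceq>\<^sub>* k. scale (c j) (mon j))" by (simp add: c_def)
  moreover have "c k = 1" by (simp add: c_def)
  ultimately show "leading_term p (mon k)"
    unfolding leading_term_def by (intro exI[of _ k] exI[of _ c]) simp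
qed

lemma Pi_star_if_monic:
  assumes "p - mon k \<in> below k"
  shows "p \<in> Pi_star k"
proof -
  have "below k \<subseteq> Pi_star k"
    unfolding below_def Pi_star_def by (intro bipoly.span_mono) (auto simp: star_le_def)
  moreover have "mon k \<in> Pi_star k"
    unfolding Pi_star_def by (intro bipoly.span_base) (use star_le_def in blast)
  ultimately show ?thesis
    using assms bipoly.span_add[of "p - mon k" _ "mon k"] unfolding Pi_star_def by auto
qed

theorem theorem5p6:
  fixes \<alpha> \<beta> :: real
  assumes "\<alpha> \<ge> - 1 / 2" and "\<beta> \<ge> - 1 / 2"
  shows "(\<forall>k :: nat \<times> nat. \<exists>P. P \<in> Pi_star k \<and> leading_term P (mon k) \<and>
            L_op \<alpha> \<beta> P = scale (complex_of_real (eigenval \<alpha> \<beta> k)) P) \<and>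
         (\<exists>!P :: nat \<times> nat \<Rightarrow> bipoly.
            (\<forall>k. P k \<in> Pi_star k \<and> leading_term (P k) (mon k) \<and>
                 L_op \<alpha> \<beta> (P k) = scale (complex_of_real (eigenval \<alpha> \<beta> k)) (P k)) \<and>
            (\<forall>k j. k \<noteq> j \<longrightarrow> inner_w \<alpha> \<beta> (P k) (P j) = 0))"
proof -
  interpret jacobi_weight \<alpha> \<beta> by unfold_locales (use assms in auto)
  obtain P where P: "\<And>k. monic_orthogonal k (P k)"
    using monic_orthogonal_exists by metis
  have eigen: "P k \<in> Pi_star k \<and> leading_term (P k) (mon k) \<and>
      L_op \<alpha> \<beta> (P k) = scale (complex_of_real (eigenval \<alpha> \<beta> k)) (P k)" for k
    using P[of k] monic_orthogonal_eigenfunction[OF P[of k]]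
    by (simp add: leading_term_mon_iff Pi_star_if_monic monic_orthogonal_def)
  show ?thesis
  proof (intro conjI allI ex1I[of _ P] impI)
    show "\<exists>P. P \<in> Pi_star k \<and> leading_term P (mon k) \<and>
        L_op \<alpha> \<beta> P = scale (complex_of_real (eigenval \<alpha> \<beta> k)) P" for k
      using eigen by blast
    show "inner_w \<alpha> \<beta> (P k) (P j) = 0" if "k \<noteq> j" for k j
      by (rule monic_orthogonal_ip[OF P P that])
    show "Q = P" if "(\<forall>k. Q k \<in> Pi_star k \<and> leading_term (Q k) (mon k) \<and>
                 L_op \<alpha> \<beta> (Q k) = scale (complex_of_real (eigenval \<alpha> \<beta> k)) (Q k)) \<and>
            (\<forall>k j. k \<noteq> j \<longrightarrow> inner_w \<alpha> \<beta> (Q k) (Q j) = 0)" for Q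
    proof
      fix k
      have "monic_orthogonal k (Q k)"
        using that by (intro monic_orthogonal_if_family) (use leading_term_mon_iff in blast)+
      then show "Q k = P k" by (rule monic_orthogonal_unique[OF _ P])
    qed
  qed (use eigen in auto)
qed

end
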